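(* Let $I$ be an ideal of a complete local Noetherian (commutative) ring $R$. Then for any Matlis-dualizable $R$-module $M$, $$(H^0_I)^{\smile}(M)=\bigl(\varinjlim_n\operatorname{tr}_{R/I^n}\bigr)^{\smile}(M)=\bigl(\varprojlim_n(\operatorname{tr}_{R/I^n}^{\smile})\bigr)(M)=\bigl(\varprojlim_n\operatorname{tom}_{R/I^n}\bigr)(M)=\bigcap_nI^nM=\ker\bigl(M\to\widehat M^I\bigr).$$
   Context: Let $E$ be the injective hull of the residue field of $R$ and $(-)^\vee=\operatorname{Hom}_R(-,E)$. A module $M$ is Matlis-dualizable if the natural map $M\to M^{\vee\vee}$ is an isomorphism; $M$ and $M^{\vee\vee}$ are identified. $H^0_I(M)=\bigcup_n(0:_MI^n)$, and $\widehat M^I$ is the $I$-adic completion of $M$. For $R$-modules $L,N$: $\operatorname{tr}_L(N)=\sum_{f\in\operatorname{Hom}_R(L,N)}f(L)$, and $\operatorname{tom}_L(N)=\{z\in N\mid x\otimes z=0\text{ in }L\otimes_RN\text{ for all }x\in L\}$. A submodule selector $\alpha$ is an isomorphism-compatible assignment of a submodule $\alpha(M)\subseteq M$ to each module $M$ of a class. Its smile dual is $\alpha^{\smile}(M):=(M^\vee/\alpha(M^\vee))^\vee$, regarded as a submodule of $M\cong M^{\vee\vee}$ via the dual of the quotient map $M^\vee\to M^\vee/\alpha(M^\vee)$. The direct limit of an increasing (directed) family $\{s_n\}$ of submodule selectors is $(\varinjlim s_n)(M)=\bigcup_ns_n(M)$, and the inverse limit of a decreasing family $\{t_n\}$ is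 $(\varprojlim t_n)(M)=\bigcap_nt_n(M)$. *)

theory Defs
  imports "HOL-Algebra.Module" "HOL-Algebra.Ideal_Product" "HOL-Algebra.Ring_Divisibility"
begin

section \<open>Modules over a commutative ring\<close>

text \<open>Records of type \<^typ>\<open>('a, 'b) module\<close> extend ring records, but the locale
  \<^locale>\<open>module\<close> does not constrain the fields \<^const>\<open>monoid.mult\<close> and \<^const>\<open>one\<close>; the
  constructions below leave them \<^const>\<open>undefined\<close>.\<close>

definition self_module :: "('a, 'r) ring_scheme \<Rightarrow> ('a, 'a) module" where
  "self_module R = \<lparr>carrier = carrier R, monoid.mult = monoid.mult R, one = one R,
     ring.zero = zero R, add = add R, smult = monoid.mult R\<rparr>"

text \<open>Homomorphisms are \<^const>\<open>undefined\<close> off the carrier of their domain, so that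
  equality of functions is equality of homomorphisms.\<close>

definition module_homs ::
  "('a, 'r) ring_scheme \<Rightarrow> ('a, 'l, 'x) module_scheme \<Rightarrow> ('a, 'n, 'y) module_scheme
     \<Rightarrow> ('l \<Rightarrow> 'n) set" where
  "module_homs R L N = {f \<in> carrier L \<rightarrow>\<^sub>E carrier N.
     (\<forall>x\<in>carrier L. \<forall>y\<in>carrier L. f (x \<oplus>\<^bsub>L\<^esub> y) = f x \<oplus>\<^bsub>N\<^esub> f y) \<and>
     (\<forall>a\<in>carrier R. \<forall>x\<in>carrier L. f (a \<odot>\<^bsub>L\<^esub> x) = a \<odot>\<^bsub>N\<^esub> f x)}"

definition hom_module ::
  "('a, 'r) ring_scheme \<Rightarrow> ('a, 'l, 'x) module_scheme \<Rightarrow> ('a, 'n, 'y) module_scheme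
     \<Rightarrow> ('a, 'l \<Rightarrow> 'n) module" where
  "hom_module R L N = \<lparr>carrier = module_homs R L N, monoid.mult = undefined, one = undefined,
     ring.zero = (\<lambda>x\<in>carrier L. \<zero>\<^bsub>N\<^esub>),
     add = (\<lambda>f g. \<lambda>x\<in>carrier L. f x \<oplus>\<^bsub>N\<^esub> g x),
     smult = (\<lambda>a f. \<lambda>x\<in>carrier L. a \<odot>\<^bsub>N\<^esub> f x)\<rparr>"

definition quot_module ::
  "('a, 'm, 'x) module_scheme \<Rightarrow> 'm set \<Rightarrow> ('a, 'm set) module" where
  "quot_module M K = \<lparr>carrier = a_rcosets\<^bsub>M\<^esub> K, monoid.mult = undefined, one = undefined,
     ring.zero = K, add = set_add M,
     smult = (\<lambda>a X. \<Union>x\<in>X. K +>\<^bsub>M\<^esub> (a \<odot>\<^bsub>M\<^esub> x))\<rparr>"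

definition quot_map :: "('a, 'm, 'x) module_scheme \<Rightarrow> 'm set \<Rightarrow> 'm \<Rightarrow> 'm set" where
  "quot_map M K = (\<lambda>x\<in>carrier M. K +>\<^bsub>M\<^esub> x)"

definition cyclic_module :: "('a, 'r) ring_scheme \<Rightarrow> 'a set \<Rightarrow> ('a, 'a set) module" where
  "cyclic_module R J = quot_module (self_module R) J"

definition submodule_span ::
  "('a, 'r) ring_scheme \<Rightarrow> ('a, 'm, 'x) module_scheme \<Rightarrow> 'm set \<Rightarrow> 'm set" where
  "submodule_span R M S = \<Inter>{K. submodule K R M \<and> S \<subseteq> K}"

primrec ideal_pow :: "('a, 'r) ring_scheme \<Rightarrow> 'a set \<Rightarrow> nat \<Rightarrow> 'a set" where
  "ideal_pow R I 0 = carrier R"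
| "ideal_pow R I (Suc n) = ideal_prod R I (ideal_pow R I n)"

definition ideal_smult ::
  "('a, 'r) ring_scheme \<Rightarrow> 'a set \<Rightarrow> ('a, 'm, 'x) module_scheme \<Rightarrow> 'm set" where
  "ideal_smult R J M = submodule_span R M {a \<odot>\<^bsub>M\<^esub> x | a x. a \<in> J \<and> x \<in> carrier M}"

section \<open>Completion\<close>

definition adic_completion ::
  "('a, 'r) ring_scheme \<Rightarrow> 'a set \<Rightarrow> ('a, 'm, 'x) module_scheme \<Rightarrow> ('a, nat \<Rightarrow> 'm set) module"
  where
  "adic_completion R I M =
    (let Q = (\<lambda>n. quot_module M (ideal_smult R (ideal_pow R I n) M)) in
     \<lparr>carrier = {s. (\<forall>n. s n \<in> carrier (Q n)) \<and>
          \<comment> \<open>the transition map sends a coset to the larger coset that contains it\<close>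
          (\<forall>n. s (Suc n) \<subseteq> s n)},
      monoid.mult = undefined, one = undefined,
      ring.zero = (\<lambda>n. \<zero>\<^bsub>Q n\<^esub>),
      add = (\<lambda>s t n. s n \<oplus>\<^bsub>Q n\<^esub> t n),
      smult = (\<lambda>a s n. a \<odot>\<^bsub>Q n\<^esub> s n)\<rparr>)"

definition to_completion ::
  "('a, 'r) ring_scheme \<Rightarrow> 'a set \<Rightarrow> ('a, 'm, 'x) module_scheme \<Rightarrow> 'm \<Rightarrow> nat \<Rightarrow> 'm set" where
  "to_completion R I M =
     (\<lambda>x\<in>carrier M. \<lambda>n. quot_map M (ideal_smult R (ideal_pow R I n) M) x)"

section \<open>Complete local Noetherian rings\<close>

definition local_ring :: "('a, 'r) ring_scheme \<Rightarrow> bool" where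
  "local_ring R \<longleftrightarrow> cring R \<and> (\<exists>!m. maximalideal m R)"

definition max_ideal :: "('a, 'r) ring_scheme \<Rightarrow> 'a set" where
  "max_ideal R = (THE m. maximalideal m R)"

definition complete_local_noetherian :: "('a, 'r) ring_scheme \<Rightarrow> bool" where
  "complete_local_noetherian R \<longleftrightarrow> noetherian_ring R \<and> local_ring R \<and>
     bij_betw (to_completion R (max_ideal R) (self_module R)) (carrier R)
       (carrier (adic_completion R (max_ideal R) (self_module R)))"

definition residue_field :: "('a, 'r) ring_scheme \<Rightarrow> ('a, 'a set) module" where
  "residue_field R = cyclic_module R (max_ideal R)"

section \<open>Injective hulls\<close>

text \<open>The first argument is the type of the elements of the test modules, because a formula
  cannot quantify over types.  The choice \<^typ>\<open>'a\<close>, the type of the elements of the ring,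
  is sufficient: by \<open>injective_module_any_type\<close> below it gives the extension property for
  test modules over every other type.\<close>

definition injective_module ::
  "'t itself \<Rightarrow> ('a, 'r) ring_scheme \<Rightarrow> ('a, 'e, 'x) module_scheme \<Rightarrow> bool" where
  "injective_module T R E \<longleftrightarrow> module R E \<and>
     (\<forall>(A :: ('a, 't) module) (B :: ('a, 't) module) i f.
        module R A \<and> module R B \<and> i \<in> module_homs R A B \<and> inj_on i (carrier A) \<and>
        f \<in> module_homs R A E \<longrightarrow>
        (\<exists>g \<in> module_homs R B E. \<forall>x\<in>carrier A. g (i x) = f x))"

definition injective_hull ::
  "('a, 'r) ring_scheme \<Rightarrow> ('a, 'k, 'y) module_scheme \<Rightarrow> ('a, 'e, 'x) module_scheme \<Rightarrow> bool"
  where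
  "injective_hull R K E \<longleftrightarrow> injective_module TYPE('a) R E \<and>
     (\<exists>\<iota> \<in> module_homs R K E. inj_on \<iota> (carrier K) \<and>
        (\<forall>U. submodule U R E \<and> U \<noteq> {\<zero>\<^bsub>E\<^esub>} \<longrightarrow> U \<inter> \<iota> ` carrier K \<noteq> {\<zero>\<^bsub>E\<^esub>}))"

lemma injective_module_any_type:
  fixes R :: "('a, 'r) ring_scheme" and E :: "('a, 'e, 'x) module_scheme"
  assumes inj: "injective_module TYPE('a) R E"
  shows "injective_module TYPE('t) R E"
  unfolding injective_module_def
proof (intro conjI allI impI)
  show "module R E" using inj by (simp add: injective_module_def)
next
  fix A B :: "('a, 't) module" and i :: "'t \<Rightarrow> 't" and f :: "'t \<Rightarrow> 'e"
  assume asm: "module R A \<and> module R B \<and> i \<in> module_homs R A B \<and> inj_on i (carrier A) \<and>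
    f \<in> module_homs R A E"
  interpret E: module R E using inj by (simp add: injective_module_def)
  interpret A: module R A using asm by simp
  interpret B: module R B using asm by simp
  have iA: "i x \<in> carrier B" "f x \<in> carrier E" if "x \<in> carrier A" for x
    using asm that by (auto simp: module_homs_def)
  have iadd: "i (x \<oplus>\<^bsub>A\<^esub> y) = i x \<oplus>\<^bsub>B\<^esub> i y" "f (x \<oplus>\<^bsub>A\<^esub> y) = f x \<oplus>\<^bsub>E\<^esub> f y"
    if "x \<in> carrier A" "y \<in> carrier A" for x y
    using asm that by (auto simp: module_homs_def)
  have ismult: "i (a \<odot>\<^bsub>A\<^esub> x) = a \<odot>\<^bsub>B\<^esub> i x" "f (a \<odot>\<^bsub>A\<^esub> x) = a \<odot>\<^bsub>E\<^esub> f x"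
    if "x \<in> carrier A" "a \<in> carrier R" for x a
    using asm that by (auto simp: module_homs_def)
  define lin where "lin G \<longleftrightarrow> G \<subseteq> carrier B \<times> carrier E \<and>
      (\<forall>u v u' v'. (u, v) \<in> G \<longrightarrow> (u', v') \<in> G \<longrightarrow> (u \<oplus>\<^bsub>B\<^esub> u', v \<oplus>\<^bsub>E\<^esub> v') \<in> G) \<and>
      (\<forall>a u v. a \<in> carrier R \<longrightarrow> (u, v) \<in> G \<longrightarrow> (a \<odot>\<^bsub>B\<^esub> u, a \<odot>\<^bsub>E\<^esub> v) \<in> G) \<and>
      (\<forall>u v v'. (u, v) \<in> G \<longrightarrow> (u, v') \<in> G \<longrightarrow> v = v')" for G
  define G0 where "G0 = (\<lambda>x. (i x, f x)) ` carrier A"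
  define S where "S = {G. lin G \<and> G0 \<subseteq> G}"
  have "G0 \<in> S"
  proof -
    have "v = v'" if "(u, v) \<in> G0" "(u, v') \<in> G0" for u v v'
      using that asm unfolding G0_def by (auto dest: inj_onD)
    moreover have "(u \<oplus>\<^bsub>B\<^esub> u', v \<oplus>\<^bsub>E\<^esub> v') \<in> G0" if "(u, v) \<in> G0" "(u', v') \<in> G0" for u v u' v'
      using that unfolding G0_def by (force simp: iadd[symmetric])
    moreover have "(a \<odot>\<^bsub>B\<^esub> u, a \<odot>\<^bsub>E\<^esub> v) \<in> G0" if "a \<in> carrier R" "(u, v) \<in> G0" for a u v
      using that unfolding G0_def by (force simp: ismult[symmetric])
    moreover have "G0 \<subseteq> carrier B \<times> carrier E"
      unfolding G0_def using iA by auto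
    ultimately show ?thesis unfolding S_def lin_def by blast
  qed
  have "\<exists>G\<in>S. \<forall>X\<in>S. G \<subseteq> X \<longrightarrow> X = G"
  proof (rule subset_Zorn_nonempty)
    show "S \<noteq> {}" using \<open>G0 \<in> S\<close> by blast
  next
    fix C assume C: "C \<noteq> {}" "subset.chain S C"
    have CS: "lin G" "G0 \<subseteq> G" if "G \<in> C" for G
      using C(2) that unfolding subset_chain_def S_def by auto
    have two: "\<exists>G\<in>C. p \<in> G \<and> q \<in> G" if "p \<in> \<Union>C" "q \<in> \<Union>C" for p q
      using that C(2) unfolding subset_chain_def by (meson UnionE subsetD)
    have "\<Union>C \<subseteq> carrier B \<times> carrier E"
      using CS(1) unfolding lin_def by blast
    moreover have "(u \<oplus>\<^bsub>B\<^esub> u', v \<oplus>\<^bsub>E\<^esub> v') \<in> \<Union>C" if "(u, v) \<in> \<Union>C" "(u', v') \<in> \<Union>C" for u v u' v'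
      using two[OF that] CS(1) unfolding lin_def by blast
    moreover have "(a \<odot>\<^bsub>B\<^esub> u, a \<odot>\<^bsub>E\<^esub> v) \<in> \<Union>C" if "a \<in> carrier R" "(u, v) \<in> \<Union>C" for a u v
      using that CS(1) unfolding lin_def by blast
    moreover have "v = v'" if "(u, v) \<in> \<Union>C" "(u, v') \<in> \<Union>C" for u v v'
      using two[OF that] CS(1) unfolding lin_def by blast
    moreover have "G0 \<subseteq> \<Union>C" using C(1) CS(2) by blast
    ultimately show "\<Union>C \<in> S" unfolding S_def lin_def by blast
  qed
  then obtain G where GS: "G \<in> S" and Gmax: "\<And>X. X \<in> S \<Longrightarrow> G \<subseteq> X \<Longrightarrow> X = G" by blast
  have G0G: "G0 \<subseteq> G" using GS by (simp add: S_def)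
  have Gcar: "u \<in> carrier B" "v \<in> carrier E" if "(u, v) \<in> G" for u v
    using GS that by (auto simp: S_def lin_def)
  have Gadd: "(u \<oplus>\<^bsub>B\<^esub> u', v \<oplus>\<^bsub>E\<^esub> v') \<in> G" if "(u, v) \<in> G" "(u', v') \<in> G" for u v u' v'
    using GS that by (auto simp: S_def lin_def)
  have Gsmult: "(a \<odot>\<^bsub>B\<^esub> u, a \<odot>\<^bsub>E\<^esub> v) \<in> G" if "a \<in> carrier R" "(u, v) \<in> G" for a u v
    using GS that by (auto simp: S_def lin_def)
  have Gfun: "v = v'" if "(u, v) \<in> G" "(u, v') \<in> G" for u v v'
    using GS that by (auto simp: S_def lin_def)
  have G0': "(\<zero>\<^bsub>B\<^esub>, \<zero>\<^bsub>E\<^esub>) \<in> G"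
  proof -
    have "(i \<zero>\<^bsub>A\<^esub>, f \<zero>\<^bsub>A\<^esub>) \<in> G" using G0G by (auto simp: G0_def)
    from Gsmult[OF _ this, of "\<zero>\<^bsub>R\<^esub>"] iA[of "\<zero>\<^bsub>A\<^esub>"] show ?thesis by simp
  qed
  have Gneg: "(\<ominus>\<^bsub>B\<^esub> u, \<ominus>\<^bsub>E\<^esub> v) \<in> G" if "(u, v) \<in> G" for u v
    using Gsmult[OF _ that, of "\<ominus>\<^bsub>R\<^esub> \<one>\<^bsub>R\<^esub>"] Gcar[OF that]
    by (simp add: B.smult_l_minus E.smult_l_minus)
  have total: "\<exists>e. (b, e) \<in> G" if b: "b \<in> carrier B" for b
  proof -
    define J where "J = {r \<in> carrier R. \<exists>e. (r \<odot>\<^bsub>B\<^esub> b, e) \<in> G}"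
    define h where "h r = (THE e. (r \<odot>\<^bsub>B\<^esub> b, e) \<in> G)" for r
    have h: "(r \<odot>\<^bsub>B\<^esub> b, h r) \<in> G" if "r \<in> J" for r
      using that Gfun theI'[of "\<lambda>e. (r \<odot>\<^bsub>B\<^esub> b, e) \<in> G"] unfolding J_def h_def by blast
    have heq: "h r = e" if "(r \<odot>\<^bsub>B\<^esub> b, e) \<in> G" for r e
      using that Gfun unfolding h_def by blast
    have JR: "r \<in> carrier R" if "r \<in> J" for r using that by (simp add: J_def)
    have Jadd: "r \<oplus>\<^bsub>R\<^esub> s \<in> J \<and> h (r \<oplus>\<^bsub>R\<^esub> s) = h r \<oplus>\<^bsub>E\<^esub> h s" if "r \<in> J" "s \<in> J" for r s
    proof -
      have "((r \<oplus>\<^bsub>R\<^esub> s) \<odot>\<^bsub>B\<^esub> b, h r \<oplus>\<^bsub>E\<^esub> h s) \<in> G"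
        using Gadd[OF h[OF that(1)] h[OF that(2)]] JR that b by (simp add: B.smult_l_distr)
      then show ?thesis using heq JR that unfolding J_def by blast
    qed
    have Jmul: "a \<otimes>\<^bsub>R\<^esub> r \<in> J \<and> h (a \<otimes>\<^bsub>R\<^esub> r) = a \<odot>\<^bsub>E\<^esub> h r" if "a \<in> carrier R" "r \<in> J" for a r
    proof -
      have "((a \<otimes>\<^bsub>R\<^esub> r) \<odot>\<^bsub>B\<^esub> b, a \<odot>\<^bsub>E\<^esub> h r) \<in> G"
        using Gsmult[OF that(1) h[OF that(2)]] JR that b by (simp add: B.smult_assoc1)
      then show ?thesis using heq JR that unfolding J_def by blast
    qed
    have J0: "\<zero>\<^bsub>R\<^esub> \<in> J" using G0' b by (auto simp: J_def)
    have self: "module R (self_module R)"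
    proof (rule moduleI)
      show "cring R" by (rule E.R.is_cring)
      show "abelian_group (self_module R)"
        by (rule abelian_groupI)
          (auto simp: self_module_def E.R.a_ac intro: E.R.l_neg E.R.a_inv_closed
            intro!: bexI[of _ "\<ominus>\<^bsub>R\<^esub> _"])
    qed (auto simp: self_module_def E.R.l_distr E.R.r_distr E.R.m_assoc)
    interpret S: module R "self_module R" by (rule self)
    have Sinv: "\<ominus>\<^bsub>self_module R\<^esub> r \<in> J" if "r \<in> J" for r
    proof -
      have rR: "r \<in> carrier (self_module R)" using JR[OF that] by (simp add: self_module_def)
      have "\<ominus>\<^bsub>self_module R\<^esub> r = (\<ominus>\<^bsub>R\<^esub> \<one>\<^bsub>R\<^esub>) \<odot>\<^bsub>self_module R\<^esub> r"
        using rR by (simp add: S.smult_l_minus)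
      also have "\<dots> = (\<ominus>\<^bsub>R\<^esub> \<one>\<^bsub>R\<^esub>) \<otimes>\<^bsub>R\<^esub> r" by (simp add: self_module_def)
      finally show ?thesis using Jmul[OF _ that, of "\<ominus>\<^bsub>R\<^esub> \<one>\<^bsub>R\<^esub>"] by simp
    qed
    have subJ: "submodule J R (self_module R)"
      by (rule S.submoduleI) (use J0 JR Jadd Jmul Sinv in \<open>auto simp: self_module_def\<close>)
    let ?J = "(self_module R)\<lparr>carrier := J\<rparr>"
    have modJ: "module R ?J" by (rule submodule.submodule_is_module[OF subJ self])
    have inc: "(\<lambda>r\<in>J. r) \<in> module_homs R ?J (self_module R)"
      using JR Jadd Jmul by (auto simp: module_homs_def self_module_def)
    have hhom: "(\<lambda>r\<in>J. h r) \<in> module_homs R ?J E"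
      using Jadd Jmul Gcar(2)[OF h] by (auto simp: module_homs_def self_module_def)
    obtain g where g: "g \<in> module_homs R (self_module R) E"
      and gh: "\<And>r. r \<in> J \<Longrightarrow> g r = h r"
    proof -
      have "inj_on (\<lambda>r\<in>J. r) (carrier ?J)" by (auto simp: inj_on_def)
      then have "\<exists>g\<in>module_homs R (self_module R) E. \<forall>x\<in>carrier ?J. g ((\<lambda>r\<in>J. r) x) = (\<lambda>r\<in>J. h r) x"
        using inj modJ self inc hhom unfolding injective_module_def by blast
      then show thesis using that by auto
    qed
    define e0 where "e0 = g \<one>\<^bsub>R\<^esub>"
    have e0: "e0 \<in> carrier E" using g by (auto simp: e0_def module_homs_def self_module_def)
    have ge0: "g r = r \<odot>\<^bsub>E\<^esub> e0" if "r \<in> carrier R" for r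
    proof -
      have "g (r \<odot>\<^bsub>self_module R\<^esub> \<one>\<^bsub>R\<^esub>) = r \<odot>\<^bsub>E\<^esub> g \<one>\<^bsub>R\<^esub>"
        using g that E.R.one_closed
        unfolding module_homs_def self_module_def by (simp del: E.R.r_one)
      then show ?thesis using that by (simp add: e0_def self_module_def)
    qed
    define G' where "G' = {(u \<oplus>\<^bsub>B\<^esub> r \<odot>\<^bsub>B\<^esub> b, v \<oplus>\<^bsub>E\<^esub> r \<odot>\<^bsub>E\<^esub> e0) | u v r. (u, v) \<in> G \<and> r \<in> carrier R}"
    have G'I: "(u \<oplus>\<^bsub>B\<^esub> r \<odot>\<^bsub>B\<^esub> b, v \<oplus>\<^bsub>E\<^esub> r \<odot>\<^bsub>E\<^esub> e0) \<in> G'" if "(u, v) \<in> G" "r \<in> carrier R" for u v r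
      using that unfolding G'_def by blast
    have GG': "G \<subseteq> G'"
    proof
      fix p assume "p \<in> G"
      then obtain u v where p: "p = (u, v)" "(u, v) \<in> G" by (cases p) auto
      show "p \<in> G'" using G'I[OF p(2), of "\<zero>\<^bsub>R\<^esub>"] Gcar[OF p(2)] b e0 p(1) by simp
    qed
    have "lin G'"
      unfolding lin_def
    proof (intro conjI allI impI)
      show "G' \<subseteq> carrier B \<times> carrier E"
        using Gcar b e0 by (auto simp: G'_def)
    next
      fix u v u' v' assume "(u, v) \<in> G'" "(u', v') \<in> G'"
      then obtain x y r x' y' r' where 1: "(x, y) \<in> G" "r \<in> carrier R" "(x', y') \<in> G" "r' \<in> carrier R"
        and 2: "u = x \<oplus>\<^bsub>B\<^esub> r \<odot>\<^bsub>B\<^esub> b" "v = y \<oplus>\<^bsub>E\<^esub> r \<odot>\<^bsub>E\<^esub> e0"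
          "u' = x' \<oplus>\<^bsub>B\<^esub> r' \<odot>\<^bsub>B\<^esub> b" "v' = y' \<oplus>\<^bsub>E\<^esub> r' \<odot>\<^bsub>E\<^esub> e0"
        unfolding G'_def by blast
      have "u \<oplus>\<^bsub>B\<^esub> u' = (x \<oplus>\<^bsub>B\<^esub> x') \<oplus>\<^bsub>B\<^esub> (r \<oplus>\<^bsub>R\<^esub> r') \<odot>\<^bsub>B\<^esub> b"
        using 1 2 Gcar b by (simp add: B.smult_l_distr B.M.a_ac)
      moreover have "v \<oplus>\<^bsub>E\<^esub> v' = (y \<oplus>\<^bsub>E\<^esub> y') \<oplus>\<^bsub>E\<^esub> (r \<oplus>\<^bsub>R\<^esub> r') \<odot>\<^bsub>E\<^esub> e0"
        using 1 2 Gcar e0 by (simp add: E.smult_l_distr E.M.a_ac)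
      ultimately show "(u \<oplus>\<^bsub>B\<^esub> u', v \<oplus>\<^bsub>E\<^esub> v') \<in> G'"
        using G'I[OF Gadd[OF 1(1,3)], of "r \<oplus>\<^bsub>R\<^esub> r'"] 1 by simp
    next
      fix a u v assume a: "a \<in> carrier R" and "(u, v) \<in> G'"
      then obtain x y r where 1: "(x, y) \<in> G" "r \<in> carrier R"
        and 2: "u = x \<oplus>\<^bsub>B\<^esub> r \<odot>\<^bsub>B\<^esub> b" "v = y \<oplus>\<^bsub>E\<^esub> r \<odot>\<^bsub>E\<^esub> e0"
        unfolding G'_def by blast
      have "a \<odot>\<^bsub>B\<^esub> u = a \<odot>\<^bsub>B\<^esub> x \<oplus>\<^bsub>B\<^esub> (a \<otimes>\<^bsub>R\<^esub> r) \<odot>\<^bsub>B\<^esub> b"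
        using 1 2 a Gcar[OF 1(1)] b by (simp add: B.smult_r_distr B.smult_assoc1)
      moreover have "a \<odot>\<^bsub>E\<^esub> v = a \<odot>\<^bsub>E\<^esub> y \<oplus>\<^bsub>E\<^esub> (a \<otimes>\<^bsub>R\<^esub> r) \<odot>\<^bsub>E\<^esub> e0"
        using 1 2 a Gcar[OF 1(1)] e0 by (simp add: E.smult_r_distr E.smult_assoc1)
      ultimately show "(a \<odot>\<^bsub>B\<^esub> u, a \<odot>\<^bsub>E\<^esub> v) \<in> G'"
        using G'I[OF Gsmult[OF a 1(1)], of "a \<otimes>\<^bsub>R\<^esub> r"] 1 a by simp
    next
      fix u v v' assume "(u, v) \<in> G'" "(u, v') \<in> G'"
      then obtain x y r x' y' r' where 1: "(x, y) \<in> G" "r \<in> carrier R" "(x', y') \<in> G" "r' \<in> carrier R"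
        and 2: "u = x \<oplus>\<^bsub>B\<^esub> r \<odot>\<^bsub>B\<^esub> b" "v = y \<oplus>\<^bsub>E\<^esub> r \<odot>\<^bsub>E\<^esub> e0"
          "u = x' \<oplus>\<^bsub>B\<^esub> r' \<odot>\<^bsub>B\<^esub> b" "v' = y' \<oplus>\<^bsub>E\<^esub> r' \<odot>\<^bsub>E\<^esub> e0"
        unfolding G'_def by blast
      note car = Gcar[OF 1(1)] Gcar[OF 1(3)]
      have eqB: "x \<oplus>\<^bsub>B\<^esub> r \<odot>\<^bsub>B\<^esub> b = x' \<oplus>\<^bsub>B\<^esub> r' \<odot>\<^bsub>B\<^esub> b" using 2 by simp
      have rr: "r \<oplus>\<^bsub>R\<^esub> \<ominus>\<^bsub>R\<^esub> r' \<in> carrier R" using 1 by simp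
      have "(r \<oplus>\<^bsub>R\<^esub> \<ominus>\<^bsub>R\<^esub> r') \<odot>\<^bsub>B\<^esub> b = r \<odot>\<^bsub>B\<^esub> b \<oplus>\<^bsub>B\<^esub> \<ominus>\<^bsub>B\<^esub> (r' \<odot>\<^bsub>B\<^esub> b)"
        using 1 b by (simp add: B.smult_l_distr B.smult_l_minus)
      also have "\<dots> = \<ominus>\<^bsub>B\<^esub> x \<oplus>\<^bsub>B\<^esub> (x \<oplus>\<^bsub>B\<^esub> r \<odot>\<^bsub>B\<^esub> b) \<oplus>\<^bsub>B\<^esub> \<ominus>\<^bsub>B\<^esub> (r' \<odot>\<^bsub>B\<^esub> b)"
        using 1 b car by (simp add: B.M.r_neg1)
      also have "\<dots> = x' \<oplus>\<^bsub>B\<^esub> \<ominus>\<^bsub>B\<^esub> x"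
        unfolding eqB using 1 b car by (simp add: B.M.a_ac B.M.r_neg B.M.r_neg2)
      finally have "((r \<oplus>\<^bsub>R\<^esub> \<ominus>\<^bsub>R\<^esub> r') \<odot>\<^bsub>B\<^esub> b, y' \<oplus>\<^bsub>E\<^esub> \<ominus>\<^bsub>E\<^esub> y) \<in> G"
        using Gadd[OF 1(3) Gneg[OF 1(1)]] by simp
      then have "r \<oplus>\<^bsub>R\<^esub> \<ominus>\<^bsub>R\<^esub> r' \<in> J" "h (r \<oplus>\<^bsub>R\<^esub> \<ominus>\<^bsub>R\<^esub> r') = y' \<oplus>\<^bsub>E\<^esub> \<ominus>\<^bsub>E\<^esub> y"
        using rr heq unfolding J_def by blast+
      then have "(r \<oplus>\<^bsub>R\<^esub> \<ominus>\<^bsub>R\<^esub> r') \<odot>\<^bsub>E\<^esub> e0 = y' \<oplus>\<^bsub>E\<^esub> \<ominus>\<^bsub>E\<^esub> y"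
        using gh ge0[OF rr] by simp
      then have eqE: "r \<odot>\<^bsub>E\<^esub> e0 \<oplus>\<^bsub>E\<^esub> \<ominus>\<^bsub>E\<^esub> (r' \<odot>\<^bsub>E\<^esub> e0) = y' \<oplus>\<^bsub>E\<^esub> \<ominus>\<^bsub>E\<^esub> y"
        using 1 e0 by (simp add: E.smult_l_distr E.smult_l_minus)
      have re: "r \<odot>\<^bsub>E\<^esub> e0 \<in> carrier E" "r' \<odot>\<^bsub>E\<^esub> e0 \<in> carrier E" using 1 e0 by auto
      have "y \<oplus>\<^bsub>E\<^esub> r \<odot>\<^bsub>E\<^esub> e0 =
          y \<oplus>\<^bsub>E\<^esub> (r \<odot>\<^bsub>E\<^esub> e0 \<oplus>\<^bsub>E\<^esub> \<ominus>\<^bsub>E\<^esub> (r' \<odot>\<^bsub>E\<^esub> e0)) \<oplus>\<^bsub>E\<^esub> r' \<odot>\<^bsub>E\<^esub> e0"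
        using car re by (simp add: E.M.a_assoc E.M.l_neg)
      also have "\<dots> = y' \<oplus>\<^bsub>E\<^esub> r' \<odot>\<^bsub>E\<^esub> e0"
        unfolding eqE using car re by (simp add: E.M.a_ac E.M.r_neg E.M.r_neg2)
      finally show "v = v'" using 2 by simp
    qed
    then have "G' \<in> S" using GG' G0G by (auto simp: S_def)
    then have "G' = G" using Gmax GG' by blast
    moreover have "(b, e0) \<in> G'" using G'I[OF G0', of "\<one>\<^bsub>R\<^esub>"] b e0 by simp
    ultimately show ?thesis by blast
  qed
  define g where "g = (\<lambda>b\<in>carrier B. THE e. (b, e) \<in> G)"
  have gG: "(b, g b) \<in> G" if "b \<in> carrier B" for b
    using total[OF that] Gfun theI'[of "\<lambda>e. (b, e) \<in> G"] that unfolding g_def by auto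
  have geq: "g b = e" if "(b, e) \<in> G" for b e
    using gG Gfun Gcar(1) that by blast
  have "g \<in> module_homs R B E"
    unfolding module_homs_def
  proof (intro CollectI conjI ballI)
    show "g \<in> carrier B \<rightarrow>\<^sub>E carrier E"
      using gG Gcar(2) by (auto simp: PiE_iff extensional_def g_def)
  qed (auto intro!: geq Gadd Gsmult gG)
  moreover have "g (i x) = f x" if "x \<in> carrier A" for x
    using geq G0G that by (auto simp: G0_def)
  ultimately show "\<exists>g\<in>module_homs R B E. \<forall>x\<in>carrier A. g (i x) = f x" by blast
qed

section \<open>Matlis duality\<close>

definition dual ::
  "('a, 'r) ring_scheme \<Rightarrow> ('a, 'e, 'x) module_scheme \<Rightarrow> ('a, 'm, 'y) module_scheme
     \<Rightarrow> ('a, 'm \<Rightarrow> 'e) module" where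
  "dual R E M = hom_module R M E"

definition dual_map ::
  "('a, 'r) ring_scheme \<Rightarrow> ('a, 'e, 'x) module_scheme
     \<Rightarrow> ('a, 'm, 'y) module_scheme \<Rightarrow> ('a, 'n, 'z) module_scheme
     \<Rightarrow> ('m \<Rightarrow> 'n) \<Rightarrow> ('n \<Rightarrow> 'e) \<Rightarrow> ('m \<Rightarrow> 'e)" where
  "dual_map R E M N q = (\<lambda>g\<in>carrier (dual R E N). compose (carrier M) g q)"

definition bidual_map ::
  "('a, 'r) ring_scheme \<Rightarrow> ('a, 'e, 'x) module_scheme \<Rightarrow> ('a, 'm, 'y) module_scheme
     \<Rightarrow> 'm \<Rightarrow> ('m \<Rightarrow> 'e) \<Rightarrow> 'e" where
  "bidual_map R E M = (\<lambda>x\<in>carrier M. \<lambda>f\<in>carrier (dual R E M). f x)"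

definition matlis_dualizable ::
  "('a, 'r) ring_scheme \<Rightarrow> ('a, 'e, 'x) module_scheme \<Rightarrow> ('a, 'm, 'y) module_scheme \<Rightarrow> bool"
  where
  "matlis_dualizable R E M \<longleftrightarrow>
     bij_betw (bidual_map R E M) (carrier M) (carrier (dual R E (dual R E M)))"

section \<open>Tensor products\<close>

definition free_module :: "('a, 'r) ring_scheme \<Rightarrow> 's set \<Rightarrow> ('a, 's \<Rightarrow> 'a) module" where
  "free_module R S = \<lparr>carrier = {c. (\<forall>p. c p \<in> carrier R) \<and> (\<forall>p. p \<notin> S \<longrightarrow> c p = \<zero>\<^bsub>R\<^esub>) \<and>
       finite {p. c p \<noteq> \<zero>\<^bsub>R\<^esub>}},
     monoid.mult = undefined, one = undefined,
     ring.zero = (\<lambda>p. \<zero>\<^bsub>R\<^esub>), add = (\<lambda>c d p. c p \<oplus>\<^bsub>R\<^esub> d p), smult = (\<lambda>a c p. a \<otimes>\<^bsub>R\<^esub> c p)\<rparr>"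

definition free_gen :: "('a, 'r) ring_scheme \<Rightarrow> 's \<Rightarrow> 's \<Rightarrow> 'a" where
  "free_gen R p = (\<lambda>q. if q = p then \<one>\<^bsub>R\<^esub> else \<zero>\<^bsub>R\<^esub>)"

definition tensor_relations ::
  "('a, 'r) ring_scheme \<Rightarrow> ('a, 'l, 'x) module_scheme \<Rightarrow> ('a, 'n, 'y) module_scheme
     \<Rightarrow> ('l \<times> 'n \<Rightarrow> 'a) set" where
  "tensor_relations R L N = (let F = free_module R (carrier L \<times> carrier N); e = free_gen R in
     {e (x \<oplus>\<^bsub>L\<^esub> y, z) \<ominus>\<^bsub>F\<^esub> (e (x, z) \<oplus>\<^bsub>F\<^esub> e (y, z)) | x y z.
        x \<in> carrier L \<and> y \<in> carrier L \<and> z \<in> carrier N} \<union>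
     {e (x, z \<oplus>\<^bsub>N\<^esub> w) \<ominus>\<^bsub>F\<^esub> (e (x, z) \<oplus>\<^bsub>F\<^esub> e (x, w)) | x z w.
        x \<in> carrier L \<and> z \<in> carrier N \<and> w \<in> carrier N} \<union>
     {e (a \<odot>\<^bsub>L\<^esub> x, z) \<ominus>\<^bsub>F\<^esub> (a \<odot>\<^bsub>F\<^esub> e (x, z)) | a x z.
        a \<in> carrier R \<and> x \<in> carrier L \<and> z \<in> carrier N} \<union>
     {e (x, a \<odot>\<^bsub>N\<^esub> z) \<ominus>\<^bsub>F\<^esub> (a \<odot>\<^bsub>F\<^esub> e (x, z)) | a x z.
        a \<in> carrier R \<and> x \<in> carrier L \<and> z \<in> carrier N})"

definition tensor_product ::
  "('a, 'r) ring_scheme \<Rightarrow> ('a, 'l, 'x) module_scheme \<Rightarrow> ('a, 'n, 'y) module_scheme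
     \<Rightarrow> ('a, ('l \<times> 'n \<Rightarrow> 'a) set) module" where
  "tensor_product R L N = (let F = free_module R (carrier L \<times> carrier N) in
     quot_module F (submodule_span R F (tensor_relations R L N)))"

definition pure_tensor ::
  "('a, 'r) ring_scheme \<Rightarrow> ('a, 'l, 'x) module_scheme \<Rightarrow> ('a, 'n, 'y) module_scheme
     \<Rightarrow> 'l \<Rightarrow> 'n \<Rightarrow> ('l \<times> 'n \<Rightarrow> 'a) set" where
  "pure_tensor R L N x z = (let F = free_module R (carrier L \<times> carrier N) in
     quot_map F (submodule_span R F (tensor_relations R L N)) (free_gen R (x, z)))"

section \<open>Submodule selectors\<close>

type_synonym ('a, 'm) selector = "('a, 'm) module \<Rightarrow> 'm set"

text \<open>A selector is polymorphic in the type of module elements; \<^typ>\<open>('a, 'm) selector\<close>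
  is its instance for modules with elements in \<^typ>\<open>'m\<close>.\<close>

definition trace_sel ::
  "('a, 'r) ring_scheme \<Rightarrow> ('a, 'l, 'x) module_scheme \<Rightarrow> ('a, 'n) selector" where
  "trace_sel R L N = {finsum N u F | F u. finite F \<and> F \<subseteq> module_homs R L N \<and>
     (\<forall>f\<in>F. u f \<in> f ` carrier L)}"

definition tom_sel ::
  "('a, 'r) ring_scheme \<Rightarrow> ('a, 'l, 'x) module_scheme \<Rightarrow> ('a, 'n) selector" where
  "tom_sel R L N = {z \<in> carrier N.
     \<forall>x\<in>carrier L. pure_tensor R L N x z = \<zero>\<^bsub>tensor_product R L N\<^esub>}"

definition local_cohomology0 :: "('a, 'r) ring_scheme \<Rightarrow> 'a set \<Rightarrow> ('a, 'm) selector" where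
  "local_cohomology0 R I M =
     (\<Union>n. {x \<in> carrier M. \<forall>a\<in>ideal_pow R I n. a \<odot>\<^bsub>M\<^esub> x = \<zero>\<^bsub>M\<^esub>})"

definition direct_limit_sel :: "(nat \<Rightarrow> ('a, 'm) selector) \<Rightarrow> ('a, 'm) selector" where
  "direct_limit_sel s M = (\<Union>n. s n M)"

definition inverse_limit_sel :: "(nat \<Rightarrow> ('a, 'm) selector) \<Rightarrow> ('a, 'm) selector" where
  "inverse_limit_sel t M = (\<Inter>n. t n M)"

text \<open>Writing \<open>D\<close> for the dual of \<open>M\<close>, the dual of \<open>D \<rightarrow> D / \<alpha> D\<close> embeds the dual of
  \<open>D / \<alpha> D\<close> into the bidual of \<open>M\<close>; its image is pulled back to \<open>M\<close> along the biduality map.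
  Only the instance of \<open>\<alpha>\<close> at the element type of \<open>D\<close> enters.\<close>

definition smile_dual ::
  "('a, 'r) ring_scheme \<Rightarrow> ('a, 'e, 'x) module_scheme \<Rightarrow> ('a, 'm \<Rightarrow> 'e) selector
     \<Rightarrow> ('a, 'm) selector" where
  "smile_dual R E \<alpha> M = (let D = dual R E M; Q = quot_module D (\<alpha> D) in
     {x \<in> carrier M. bidual_map R E M x \<in>
        dual_map R E D Q (quot_map D (\<alpha> D)) ` carrier (dual R E Q)})"

end

theory Submission
  imports Defs
begin

text \<open>An element of \<open>M\<close> lies in \<open>\<alpha>\<^sup>\<smile>(M)\<close> iff every functional in \<open>\<alpha>(M\<^sup>\<or>)\<close> vanishes on it; this
  turns the union over \<open>n\<close> into an intersection.  A homomorphism from \<open>R/J\<close> is the choice of an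
  element annihilated by \<open>J\<close>, so \<open>tr\<close> of \<open>R/J\<close> on \<open>M\<^sup>\<or>\<close> consists of the functionals that vanish on
  \<open>JM\<close>, and because \<open>E\<close> is an injective cogenerator, the elements killed by all of them are exactly
  those of \<open>JM\<close>.  The same functionals detect \<open>tom\<close>: if \<open>f\<close> kills \<open>JM\<close>, then \<open>(r + J, z) \<mapsto> r f(z)\<close>
  is bilinear, so \<open>1 \<otimes> z = 0\<close> forces \<open>f(z) = 0\<close>.\<close>

section \<open>Homomorphisms, submodules and quotients\<close>

lemma module_homsD:
  assumes "f \<in> module_homs R L N"
  shows "x \<in> carrier L \<Longrightarrow> f x \<in> carrier N"
    and "x \<in> carrier L \<Longrightarrow> y \<in> carrier L \<Longrightarrow> f (x \<oplus>\<^bsub>L\<^esub> y) = f x \<oplus>\<^bsub>N\<^esub> f y"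
    and "a \<in> carrier R \<Longrightarrow> x \<in> carrier L \<Longrightarrow> f (a \<odot>\<^bsub>L\<^esub> x) = a \<odot>\<^bsub>N\<^esub> f x"
  using assms by (auto simp: module_homs_def)

text \<open>Homomorphisms are undefined off the carrier, so most maps below are built with
  \<open>restrict\<close>; the closure hypotheses on \<open>L\<close> let such a restriction be
  evaluated at sums and multiples.\<close>

lemma restrict_in_module_homs:
  assumes "\<And>x. x \<in> carrier L \<Longrightarrow> f x \<in> carrier N"
    and "\<And>x y. x \<in> carrier L \<Longrightarrow> y \<in> carrier L \<Longrightarrow> x \<oplus>\<^bsub>L\<^esub> y \<in> carrier L"
    and "\<And>a x. a \<in> carrier R \<Longrightarrow> x \<in> carrier L \<Longrightarrow> a \<odot>\<^bsub>L\<^esub> x \<in> carrier L"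
    and "\<And>x y. x \<in> carrier L \<Longrightarrow> y \<in> carrier L \<Longrightarrow> f (x \<oplus>\<^bsub>L\<^esub> y) = f x \<oplus>\<^bsub>N\<^esub> f y"
    and "\<And>a x. a \<in> carrier R \<Longrightarrow> x \<in> carrier L \<Longrightarrow> f (a \<odot>\<^bsub>L\<^esub> x) = a \<odot>\<^bsub>N\<^esub> f x"
  shows "(\<lambda>x\<in>carrier L. f x) \<in> module_homs R L N"
  using assms by (auto simp: module_homs_def)

context module
begin

lemma module_hom_zero:
  assumes "module R L" "f \<in> module_homs R M L"
  shows "f \<zero>\<^bsub>M\<^esub> = \<zero>\<^bsub>L\<^esub>"
proof -
  interpret L: module R L by fact
  have "f (\<zero>\<^bsub>R\<^esub> \<odot>\<^bsub>M\<^esub> \<zero>\<^bsub>M\<^esub>) = \<zero>\<^bsub>R\<^esub> \<odot>\<^bsub>L\<^esub> f \<zero>\<^bsub>M\<^esub>"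
    by (rule module_homsD[OF assms(2)]) auto
  then show ?thesis using module_homsD(1)[OF assms(2), of "\<zero>\<^bsub>M\<^esub>"] by simp
qed

lemma submodule_criterion:
  assumes "H \<subseteq> carrier M" "\<zero>\<^bsub>M\<^esub> \<in> H"
    and "\<And>x y. x \<in> H \<Longrightarrow> y \<in> H \<Longrightarrow> x \<oplus>\<^bsub>M\<^esub> y \<in> H"
    and "\<And>a x. a \<in> carrier R \<Longrightarrow> x \<in> H \<Longrightarrow> a \<odot>\<^bsub>M\<^esub> x \<in> H"
  shows "submodule H R M"
proof (rule submoduleI)
  fix x assume x: "x \<in> H"
  then have "\<ominus>\<^bsub>M\<^esub> x = (\<ominus>\<^bsub>R\<^esub> \<one>\<^bsub>R\<^esub>) \<odot>\<^bsub>M\<^esub> x"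
    using assms(1) by (auto simp: smult_l_minus)
  with assms(4) x show "\<ominus>\<^bsub>M\<^esub> x \<in> H" by simp
qed (use assms in auto)

lemma submodule_carrier: "submodule K R M \<Longrightarrow> x \<in> K \<Longrightarrow> x \<in> carrier M"
  using submoduleE(1) by blast

lemma submodule_zero: "submodule K R M \<Longrightarrow> \<zero>\<^bsub>M\<^esub> \<in> K"
  using subgroup.one_closed[OF submodule.axioms(1)] by fastforce

lemma submodule_kernel:
  assumes "module R L" "f \<in> module_homs R M L"
  shows "submodule {x \<in> carrier M. f x = \<zero>\<^bsub>L\<^esub>} R M"
proof -
  interpret L: module R L by fact
  show ?thesis
    by (rule submodule_criterion)
      (auto simp: module_hom_zero[OF assms] module_homsD[OF assms(2)])
qed

section \<open>Generated submodules and the products JM\<close>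

lemma submodule_span_superset: "S \<subseteq> submodule_span R M S"
  by (auto simp: submodule_span_def)

lemma submodule_span_least:
  "submodule K R M \<Longrightarrow> S \<subseteq> K \<Longrightarrow> submodule_span R M S \<subseteq> K"
  by (auto simp: submodule_span_def)

lemma submodule_submodule_span:
  assumes "S \<subseteq> carrier M"
  shows "submodule (submodule_span R M S) R M"
proof (rule submodule_criterion)
  show "submodule_span R M S \<subseteq> carrier M"
    using submodule_span_least[OF carrier_is_submodule assms] .
qed (auto simp: submodule_span_def submodule_zero submoduleE)

lemma submodule_ideal_smult:
  "J \<subseteq> carrier R \<Longrightarrow> submodule (ideal_smult R J M) R M"
  unfolding ideal_smult_def by (rule submodule_submodule_span) auto

lemma ideal_smult_memI:
  "a \<in> J \<Longrightarrow> x \<in> carrier M \<Longrightarrow> a \<odot>\<^bsub>M\<^esub> x \<in> ideal_smult R J M"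
  unfolding ideal_smult_def by (rule subsetD[OF submodule_span_superset]) blast

text \<open>The kernel of \<open>f\<close> is a submodule, so it contains JM as soon as it contains
  the generators. For functionals, this turns being annihilated by J in the dual into vanishing on
  JM.\<close>

lemma hom_vanishes_on_ideal_smult_iff:
  assumes "module R L" "f \<in> module_homs R M L" "J \<subseteq> carrier R"
  shows "(\<forall>z\<in>ideal_smult R J M. f z = \<zero>\<^bsub>L\<^esub>) \<longleftrightarrow>
    (\<forall>a\<in>J. \<forall>x\<in>carrier M. a \<odot>\<^bsub>L\<^esub> f x = \<zero>\<^bsub>L\<^esub>)"
proof
  assume "\<forall>z\<in>ideal_smult R J M. f z = \<zero>\<^bsub>L\<^esub>"
  then have "f (a \<odot>\<^bsub>M\<^esub> x) = \<zero>\<^bsub>L\<^esub>" if "a \<in> J" "x \<in> carrier M" for a x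
    using ideal_smult_memI[OF that] by blast
  then show "\<forall>a\<in>J. \<forall>x\<in>carrier M. a \<odot>\<^bsub>L\<^esub> f x = \<zero>\<^bsub>L\<^esub>"
    using module_homsD(3)[OF assms(2)] assms(3) by (simp add: subset_iff)
next
  assume "\<forall>a\<in>J. \<forall>x\<in>carrier M. a \<odot>\<^bsub>L\<^esub> f x = \<zero>\<^bsub>L\<^esub>"
  then have "{a \<odot>\<^bsub>M\<^esub> x | a x. a \<in> J \<and> x \<in> carrier M} \<subseteq> {x \<in> carrier M. f x = \<zero>\<^bsub>L\<^esub>}"
    using module_homsD(3)[OF assms(2)] assms(3) by auto
  from submodule_span_least[OF submodule_kernel[OF assms(1,2)] this]
  show "\<forall>z\<in>ideal_smult R J M. f z = \<zero>\<^bsub>L\<^esub>" by (auto simp: ideal_smult_def)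
qed

section \<open>Cosets and quotient modules\<close>

lemma abelian_subgroup_submodule:
  assumes "submodule K R M"
  shows "abelian_subgroup K M"
  by (rule abelian_subgroupI3)
    (use submodule.axioms(1)[OF assms] in \<open>auto intro: additive_subgroup.intro M.abelian_group_axioms\<close>)

lemma coset_eq_self_iff:
  assumes "submodule K R M" "x \<in> carrier M"
  shows "K +>\<^bsub>M\<^esub> x = K \<longleftrightarrow> x \<in> K"
proof -
  interpret K: abelian_subgroup K M by (rule abelian_subgroup_submodule[OF assms(1)])
  show ?thesis using K.a_rcos_self[OF assms(2)] K.a_rcos_const by auto
qed

lemma coset_eqD:
  assumes "submodule K R M" "x \<in> carrier M" "y \<in> carrier M" "K +>\<^bsub>M\<^esub> x = K +>\<^bsub>M\<^esub> y"
  shows "\<exists>k\<in>K. x = k \<oplus>\<^bsub>M\<^esub> y"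
proof -
  interpret K: abelian_subgroup K M by (rule abelian_subgroup_submodule[OF assms(1)])
  have "x \<in> K +>\<^bsub>M\<^esub> y" using K.a_rcos_self[OF assms(2)] assms(4) by simp
  then show ?thesis by (auto simp: a_r_coset_def')
qed

lemma coset_absorb:
  assumes "submodule K R M" "k \<in> K" "x \<in> carrier M"
  shows "K +>\<^bsub>M\<^esub> (k \<oplus>\<^bsub>M\<^esub> x) = K +>\<^bsub>M\<^esub> x"
proof -
  interpret K: abelian_subgroup K M by (rule abelian_subgroup_submodule[OF assms(1)])
  have "k \<oplus>\<^bsub>M\<^esub> x \<in> K +>\<^bsub>M\<^esub> x" using assms by (auto simp: a_r_coset_def')
  then show ?thesis using K.a_repr_independence' assms by simp
qed

lemma quot_module_carrier:
  "carrier (quot_module M K) = (\<lambda>x. K +>\<^bsub>M\<^esub> x) ` carrier M"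
  by (auto simp: quot_module_def A_RCOSETS_def')

lemma quot_module_zero: "\<zero>\<^bsub>quot_module M K\<^esub> = K"
  by (simp add: quot_module_def)

lemma quot_module_add:
  assumes "submodule K R M" "x \<in> carrier M" "y \<in> carrier M"
  shows "(K +>\<^bsub>M\<^esub> x) \<oplus>\<^bsub>quot_module M K\<^esub> (K +>\<^bsub>M\<^esub> y) = K +>\<^bsub>M\<^esub> (x \<oplus>\<^bsub>M\<^esub> y)"
proof -
  interpret K: abelian_subgroup K M by (rule abelian_subgroup_submodule[OF assms(1)])
  show ?thesis using K.a_rcos_sum assms by (simp add: quot_module_def)
qed

lemma quot_module_smult:
  assumes "submodule K R M" "a \<in> carrier R" "x \<in> carrier M"
  shows "a \<odot>\<^bsub>quot_module M K\<^esub> (K +>\<^bsub>M\<^esub> x) = K +>\<^bsub>M\<^esub> (a \<odot>\<^bsub>M\<^esub> x)"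
proof -
  interpret K: abelian_subgroup K M by (rule abelian_subgroup_submodule[OF assms(1)])
  \<comment> \<open>The scalar action on the quotient is a union over all representatives. Passing
    from x to k + x changes a x by a k, which lies in K, so all cosets in the union
    coincide.\<close>
  have "K +>\<^bsub>M\<^esub> (a \<odot>\<^bsub>M\<^esub> y) = K +>\<^bsub>M\<^esub> (a \<odot>\<^bsub>M\<^esub> x)" if y: "y \<in> K +>\<^bsub>M\<^esub> x" for y
  proof -
    obtain k where k: "k \<in> K" "y = k \<oplus>\<^bsub>M\<^esub> x" using y by (auto simp: a_r_coset_def')
    then have "a \<odot>\<^bsub>M\<^esub> y = a \<odot>\<^bsub>M\<^esub> k \<oplus>\<^bsub>M\<^esub> a \<odot>\<^bsub>M\<^esub> x"
      using assms by (simp add: smult_r_distr)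
    then show ?thesis using coset_absorb submoduleE(4)[OF assms(1)] k assms by simp
  qed
  then have "(\<Union>y\<in>K +>\<^bsub>M\<^esub> x. K +>\<^bsub>M\<^esub> (a \<odot>\<^bsub>M\<^esub> y)) = K +>\<^bsub>M\<^esub> (a \<odot>\<^bsub>M\<^esub> x)"
    by (intro UN_constant_eq[OF K.a_rcos_self[OF assms(3)]] ballI)
  then show ?thesis by (simp add: quot_module_def)
qed

lemma module_quot_module:
  assumes K: "submodule K R M"
  shows "module R (quot_module M K)"
proof (rule moduleI)
  let ?Q = "quot_module M K"
  \<comment> \<open>The zero of the quotient is K itself; written as the coset of 0 it falls under
    the addition rule for cosets.\<close>
  have zero: "\<zero>\<^bsub>?Q\<^esub> = K +>\<^bsub>M\<^esub> \<zero>\<^bsub>M\<^esub>"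
    using coset_eq_self_iff[OF K, of "\<zero>\<^bsub>M\<^esub>"] submodule_zero[OF K] by (simp add: quot_module_zero)
  show "abelian_group ?Q"
  proof (rule abelian_groupI)
    fix X assume "X \<in> carrier ?Q"
    then obtain x where x: "x \<in> carrier M" "X = K +>\<^bsub>M\<^esub> x" by (auto simp: quot_module_carrier)
    then have "(K +>\<^bsub>M\<^esub> (\<ominus>\<^bsub>M\<^esub> x)) \<oplus>\<^bsub>?Q\<^esub> X = \<zero>\<^bsub>?Q\<^esub>"
      by (simp add: quot_module_add K zero M.l_neg)
    then show "\<exists>Y\<in>carrier ?Q. Y \<oplus>\<^bsub>?Q\<^esub> X = \<zero>\<^bsub>?Q\<^esub>"
      using x(1) by (auto simp: quot_module_carrier)
  qed (auto simp: quot_module_carrier zero quot_module_add K M.a_ac)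
qed (auto simp: quot_module_carrier R.is_cring quot_module_add quot_module_smult K smult_l_distr
    smult_r_distr smult_assoc1)

lemma hom_factors_through_quot:
  assumes "module R L" "submodule K R M" "f \<in> module_homs R M L"
    and "\<And>k. k \<in> K \<Longrightarrow> f k = \<zero>\<^bsub>L\<^esub>"
  obtains g where "g \<in> module_homs R (quot_module M K) L"
    and "\<And>x. x \<in> carrier M \<Longrightarrow> g (K +>\<^bsub>M\<^esub> x) = f x"
proof -
  interpret L: module R L by fact
  let ?Q = "quot_module M K"
  note f = module_homsD[OF assms(3)]
  \<comment> \<open>The value is read off an arbitrary representative; two representatives differ by
    an element of K, where \<open>f\<close> vanishes.\<close>
  define g where "g = (\<lambda>X\<in>carrier ?Q. f (SOME x. x \<in> carrier M \<and> X = K +>\<^bsub>M\<^esub> x))"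
  have g: "g (K +>\<^bsub>M\<^esub> x) = f x" if x: "x \<in> carrier M" for x
  proof -
    let ?y = "SOME y. y \<in> carrier M \<and> K +>\<^bsub>M\<^esub> x = K +>\<^bsub>M\<^esub> y"
    have y: "?y \<in> carrier M \<and> K +>\<^bsub>M\<^esub> x = K +>\<^bsub>M\<^esub> ?y"
      by (rule someI_ex) (use x in blast)
    then obtain k where k: "k \<in> K" "x = k \<oplus>\<^bsub>M\<^esub> ?y" using coset_eqD assms(2) x by blast
    have "f x = f (k \<oplus>\<^bsub>M\<^esub> ?y)" using k(2) by simp
    also have "\<dots> = f ?y" using k(1) y assms(2,4) submodule_carrier by (simp add: f)
    finally show ?thesis using x by (simp add: g_def quot_module_carrier)
  qed
  have "g \<in> module_homs R ?Q L"
    unfolding module_homs_def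
  proof (intro CollectI conjI ballI)
    show "g \<in> carrier ?Q \<rightarrow>\<^sub>E carrier L"
    proof (rule PiE_I)
      show "g X \<in> carrier L" if "X \<in> carrier ?Q" for X
        using that g f(1) by (auto simp: quot_module_carrier)
    qed (simp add: g_def)
  qed (auto simp: quot_module_carrier quot_module_add quot_module_smult assms(2) g f)
  from this g show thesis by (rule that)
qed

section \<open>Modules of homomorphisms\<close>

lemma module_hom_module:
  assumes "module R L"
  shows "module R (hom_module R M L)"
proof -
  interpret L: module R L by fact
  have add: "(\<lambda>x\<in>carrier M. f x \<oplus>\<^bsub>L\<^esub> g x) \<in> module_homs R M L"
    if "f \<in> module_homs R M L" "g \<in> module_homs R M L" for f g
    by (rule restrict_in_module_homs)
      (auto simp: module_homsD[OF that(1)] module_homsD[OF that(2)] L.smult_r_distr L.M.a_ac)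
  \<comment> \<open>Commutativity of R makes a multiple of a homomorphism linear again.\<close>
  have smult: "(\<lambda>x\<in>carrier M. a \<odot>\<^bsub>L\<^esub> f x) \<in> module_homs R M L"
    if "a \<in> carrier R" "f \<in> module_homs R M L" for a f
    by (rule restrict_in_module_homs)
      (auto simp: module_homsD[OF that(2)] that(1) L.smult_r_distr L.smult_assoc1[symmetric] R.m_comm)
  have zero: "(\<lambda>x\<in>carrier M. \<zero>\<^bsub>L\<^esub>) \<in> module_homs R M L"
    by (rule restrict_in_module_homs) auto
  \<comment> \<open>Both functions are undefined off the carrier, so agreement on it is equality;
    this reduces the module axioms to pointwise identities.\<close>
  have eqI: "f = g" if "f \<in> module_homs R M L" "g \<in> module_homs R M L"
    "\<And>x. x \<in> carrier M \<Longrightarrow> f x = g x" for f g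
    using that unfolding module_homs_def by (blast intro: PiE_ext)
  show ?thesis
  proof (rule moduleI)
    show "abelian_group (hom_module R M L)"
    proof (rule abelian_groupI)
      fix f assume f: "f \<in> carrier (hom_module R M L)"
      \<comment> \<open>The additive inverse is taken as the multiple by -1, so that its linearity
        is an instance of \<open>smult\<close>.\<close>
      show "\<exists>g\<in>carrier (hom_module R M L). g \<oplus>\<^bsub>hom_module R M L\<^esub> f = \<zero>\<^bsub>hom_module R M L\<^esub>"
        using f smult[of "\<ominus>\<^bsub>R\<^esub> \<one>\<^bsub>R\<^esub>" f]
        by (intro bexI[of _ "\<lambda>x\<in>carrier M. (\<ominus>\<^bsub>R\<^esub> \<one>\<^bsub>R\<^esub>) \<odot>\<^bsub>L\<^esub> f x"])
          (auto simp: hom_module_def module_homsD L.smult_l_minus L.M.l_neg)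
    next
      fix f assume f: "f \<in> carrier (hom_module R M L)"
      then have "\<zero>\<^bsub>hom_module R M L\<^esub> \<oplus>\<^bsub>hom_module R M L\<^esub> f \<in> module_homs R M L"
        using add[OF zero] by (simp add: hom_module_def)
      then show "\<zero>\<^bsub>hom_module R M L\<^esub> \<oplus>\<^bsub>hom_module R M L\<^esub> f = f"
        using f by (intro eqI) (auto simp: hom_module_def module_homsD)
    qed (auto simp: hom_module_def add zero module_homsD L.M.a_ac intro!: eqI restrict_ext)
  qed (auto simp: hom_module_def R.is_cring add smult module_homsD L.smult_l_distr
      L.smult_r_distr L.smult_assoc1 intro!: eqI restrict_ext)
qed

end

section \<open>The ring as a module over itself\<close>

lemma module_self_module:
  assumes "cring R"
  shows "module R (self_module R)"
proof -
  interpret cring R by fact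
  show ?thesis
  proof (rule moduleI)
    show "abelian_group (self_module R)"
      by (rule abelian_groupI)
        (auto simp: self_module_def a_ac l_neg intro!: bexI[of _ "\<ominus>\<^bsub>R\<^esub> _"])
  qed (auto simp: self_module_def l_distr r_distr m_assoc assms)
qed

lemma submodule_self_module:
  assumes "cring R" "ideal J R"
  shows "submodule J R (self_module R)"
proof -
  interpret ideal J R by fact
  interpret S: module R "self_module R" by (rule module_self_module[OF assms(1)])
  show ?thesis
    by (rule S.submodule_criterion) (auto simp: self_module_def I_l_closed)
qed


section \<open>The injective hull of the residue field\<close>

text \<open>Zorn's lemma on the proper ideals containing J. In a Noetherian ring a nonempty chain of
  ideals contains its own union, so this upper bound is proper simply as a member of the
  chain.\<close>

lemma (in noetherian_ring) proper_ideal_subset_maximalideal: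
  assumes "ideal J R" "J \<noteq> carrier R"
  obtains m where "maximalideal m R" "J \<subseteq> m"
proof -
  define S where "S = {A. ideal A R \<and> A \<noteq> carrier R \<and> J \<subseteq> A}"
  have "\<exists>m\<in>S. \<forall>X\<in>S. m \<subseteq> X \<longrightarrow> X = m"
  proof (rule subset_Zorn_nonempty)
    show "S \<noteq> {}" using assms by (auto simp: S_def)
  next
    fix C assume C: "C \<noteq> {}" "subset.chain S C"
    then have "subset.chain {A. ideal A R} C"
      unfolding pred_on.chain_def S_def by blast
    then have "\<Union>C \<in> C" by (rule ideal_chain_is_trivial[OF C(1)])
    then show "\<Union>C \<in> S" using C(2) unfolding pred_on.chain_def by blast
  qed
  then obtain m where m: "m \<in> S" "\<And>X. X \<in> S \<Longrightarrow> m \<subseteq> X \<Longrightarrow> X = m" by blast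
  have "maximalideal m R"
  proof (rule maximalidealI)
    fix A assume "ideal A R" "m \<subseteq> A" "A \<subseteq> carrier R"
    then show "A = m \<or> A = carrier R" using m unfolding S_def by blast
  qed (use m(1) in \<open>auto simp: S_def\<close>)
  then show thesis using m(1) that by (auto simp: S_def)
qed

lemma maximalideal_max_ideal:
  "local_ring R \<Longrightarrow> maximalideal (max_ideal R) R"
  unfolding local_ring_def max_ideal_def by (elim conjE) (rule theI')

lemma maximalideal_eq_max_ideal:
  "local_ring R \<Longrightarrow> maximalideal m R \<Longrightarrow> m = max_ideal R"
  using maximalideal_max_ideal unfolding local_ring_def by blast

lemma proper_ideal_subset_max_ideal:
  assumes "noetherian_ring R" "local_ring R" "ideal J R" "J \<noteq> carrier R"
  shows "J \<subseteq> max_ideal R"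
  using noetherian_ring.proper_ideal_subset_maximalideal[OF assms(1,3,4)]
    maximalideal_eq_max_ideal[OF assms(2)] by metis

text \<open>The residue field embeds in E, and the image of the coset of 1 is the element sought:
  the maximal ideal kills that coset, and injectivity keeps its image nonzero.\<close>

lemma injective_hull_socle_element:
  assumes "local_ring R" "injective_hull R (residue_field R) E"
  obtains u where "u \<in> carrier E" "u \<noteq> \<zero>\<^bsub>E\<^esub>" "\<And>a. a \<in> max_ideal R \<Longrightarrow> a \<odot>\<^bsub>E\<^esub> u = \<zero>\<^bsub>E\<^esub>"
proof -
  let ?m = "max_ideal R"
  interpret m: maximalideal ?m R by (rule maximalideal_max_ideal[OF assms(1)])
  have R: "cring R" using assms(1) by (simp add: local_ring_def)
  interpret E: module R E using assms(2) by (simp add: injective_hull_def injective_module_def)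
  interpret S: module R "self_module R" by (rule module_self_module[OF R])
  have sub: "submodule ?m R (self_module R)"
    by (rule submodule_self_module[OF R m.is_ideal])
  obtain \<iota> where \<iota>: "\<iota> \<in> module_homs R (quot_module (self_module R) ?m) E"
    and inj: "inj_on \<iota> (carrier (quot_module (self_module R) ?m))"
    using assms(2) unfolding injective_hull_def residue_field_def cyclic_module_def by blast
  let ?q = "\<lambda>r. ?m +>\<^bsub>self_module R\<^esub> r"
  have car: "carrier (self_module R) = carrier R" by (simp add: self_module_def)
  have q: "?q r \<in> carrier (quot_module (self_module R) ?m)" if "r \<in> carrier R" for r
    using that by (auto simp: S.quot_module_carrier car)
  have mul: "\<iota> (?q a) = a \<odot>\<^bsub>E\<^esub> \<iota> (?q \<one>\<^bsub>R\<^esub>)" if a: "a \<in> carrier R" for a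
    using module_homsD(3)[OF \<iota> a q[of "\<one>\<^bsub>R\<^esub>"]] S.quot_module_smult[OF sub a, of "\<one>\<^bsub>R\<^esub>"] a
    by (simp add: car) (simp add: self_module_def)
  have u: "\<iota> (?q \<one>\<^bsub>R\<^esub>) \<in> carrier E" by (rule module_homsD(1)[OF \<iota>]) (simp add: q)
  have zero: "\<iota> (?q a) = \<zero>\<^bsub>E\<^esub>" if "a \<in> ?m" for a
  proof -
    \<comment> \<open>An element of the maximal ideal has the same coset as 0, where
      \<open>mul\<close> gives the value 0.\<close>
    have "?q a = ?m" "?q \<zero>\<^bsub>R\<^esub> = ?m"
      using S.coset_eq_self_iff[OF sub] that m.Icarr by (auto simp: car)
    then show ?thesis using mul[of "\<zero>\<^bsub>R\<^esub>"] u by simp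
  qed
  show thesis
  proof (rule that[OF u])
    show "\<iota> (?q \<one>\<^bsub>R\<^esub>) \<noteq> \<zero>\<^bsub>E\<^esub>"
    proof
      assume "\<iota> (?q \<one>\<^bsub>R\<^esub>) = \<zero>\<^bsub>E\<^esub>"
      then have "?q \<one>\<^bsub>R\<^esub> = ?q \<zero>\<^bsub>R\<^esub>"
        using zero[of "\<zero>\<^bsub>R\<^esub>"] by (intro inj_onD[OF inj]) (auto simp: q)
      also have "\<dots> = ?m" using S.coset_eq_self_iff[OF sub] by (simp add: car)
      finally have "\<one>\<^bsub>R\<^esub> \<in> ?m" using S.coset_eq_self_iff[OF sub] by (simp add: car)
      then show False using m.one_imp_carrier m.I_notcarr by blast
    qed
  next
    fix a assume "a \<in> ?m"
    then show "a \<odot>\<^bsub>E\<^esub> \<iota> (?q \<one>\<^bsub>R\<^esub>) = \<zero>\<^bsub>E\<^esub>"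
      by (metis mul zero m.Icarr)
  qed
qed

text \<open>The functional sends \<open>k + r x\<close> to \<open>r u\<close> for a socle element \<open>u\<close> of \<open>E\<close> and is then
  extended by injectivity; it is well defined because \<open>{r. r x \<in> K}\<close> is a proper ideal.\<close>

lemma injective_hull_separates_points:
  fixes M :: "('a, 'm) module"
  assumes "noetherian_ring R" "local_ring R" "injective_hull R (residue_field R) E"
    and "module R M" "submodule K R M" "x \<in> carrier M" "x \<notin> K"
  obtains f where "f \<in> module_homs R M E" "\<And>k. k \<in> K \<Longrightarrow> f k = \<zero>\<^bsub>E\<^esub>" "f x \<noteq> \<zero>\<^bsub>E\<^esub>"
proof -
  interpret M: module R M by fact
  \<comment> \<open>The hull is injective against test modules with elements of the type of R; the
    extension below takes place in M, so injectivity is carried over to the element type of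
    M.\<close>
  have injE: "injective_module TYPE('m) R E"
    using assms(3) injective_module_any_type by (auto simp: injective_hull_def)
  interpret E: module R E using injE by (simp add: injective_module_def)
  obtain u where u: "u \<in> carrier E" "u \<noteq> \<zero>\<^bsub>E\<^esub>" "\<And>a. a \<in> max_ideal R \<Longrightarrow> a \<odot>\<^bsub>E\<^esub> u = \<zero>\<^bsub>E\<^esub>"
    by (rule injective_hull_socle_element[OF assms(2,3)]) blast
  note K = M.submoduleE(3-5)[OF assms(5)] M.submodule_zero[OF assms(5)] M.submodule_carrier[OF assms(5)]
  define J where "J = {r \<in> carrier R. r \<odot>\<^bsub>M\<^esub> x \<in> K}"
  have "ideal J R"
  proof (rule idealI)
    show "subgroup J (add_monoid R)"
      by unfold_locales
        (auto simp: J_def M.smult_l_distr K assms(6) M.smult_l_minus simp flip: a_inv_def)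
  next
    fix r s assume rs: "r \<in> J" "s \<in> carrier R"
    then have "(s \<otimes>\<^bsub>R\<^esub> r) \<odot>\<^bsub>M\<^esub> x \<in> K"
      using assms(6) K by (simp add: J_def M.smult_assoc1)
    then show "s \<otimes>\<^bsub>R\<^esub> r \<in> J" using rs by (simp add: J_def)
    then show "r \<otimes>\<^bsub>R\<^esub> s \<in> J" using rs by (simp add: J_def M.R.m_comm)
  qed (rule M.R.ring_axioms)
  \<comment> \<open>As x lies outside K, the ideal J is proper and hence contained in the maximal
    ideal, which kills u.\<close>
  moreover have "\<one>\<^bsub>R\<^esub> \<notin> J" using assms(6,7) by (simp add: J_def)
  ultimately have J: "J \<subseteq> max_ideal R"
    by (intro proper_ideal_subset_max_ideal[OF assms(1,2)]) auto
  define H where "H = {k \<oplus>\<^bsub>M\<^esub> r \<odot>\<^bsub>M\<^esub> x | k r. k \<in> K \<and> r \<in> carrier R}"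
  have HI: "k \<oplus>\<^bsub>M\<^esub> r \<odot>\<^bsub>M\<^esub> x \<in> H" if "k \<in> K" "r \<in> carrier R" for k r
    using that by (auto simp: H_def)
  have add: "(k \<oplus>\<^bsub>M\<^esub> r \<odot>\<^bsub>M\<^esub> x) \<oplus>\<^bsub>M\<^esub> (k' \<oplus>\<^bsub>M\<^esub> r' \<odot>\<^bsub>M\<^esub> x) =
      (k \<oplus>\<^bsub>M\<^esub> k') \<oplus>\<^bsub>M\<^esub> (r \<oplus>\<^bsub>R\<^esub> r') \<odot>\<^bsub>M\<^esub> x"
    if "k \<in> K" "r \<in> carrier R" "k' \<in> K" "r' \<in> carrier R" for k r k' r'
    using that K assms(6) by (simp add: M.smult_l_distr M.M.a_ac)
  have smult: "a \<odot>\<^bsub>M\<^esub> (k \<oplus>\<^bsub>M\<^esub> r \<odot>\<^bsub>M\<^esub> x) = a \<odot>\<^bsub>M\<^esub> k \<oplus>\<^bsub>M\<^esub> (a \<otimes>\<^bsub>R\<^esub> r) \<odot>\<^bsub>M\<^esub> x"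
    if "k \<in> K" "r \<in> carrier R" "a \<in> carrier R" for k r a
    using that K assms(6) by (simp add: M.smult_r_distr M.smult_assoc1)
  have subH: "submodule H R M"
  proof (rule M.submodule_criterion)
    show "H \<subseteq> carrier M" using K assms(6) by (auto simp: H_def)
    show "\<zero>\<^bsub>M\<^esub> \<in> H" using HI[of "\<zero>\<^bsub>M\<^esub>" "\<zero>\<^bsub>R\<^esub>"] K assms(6) by simp
  next
    fix y z assume "y \<in> H" "z \<in> H"
    then obtain k r k' r' where "y = k \<oplus>\<^bsub>M\<^esub> r \<odot>\<^bsub>M\<^esub> x" "z = k' \<oplus>\<^bsub>M\<^esub> r' \<odot>\<^bsub>M\<^esub> x"
      "k \<in> K" "r \<in> carrier R" "k' \<in> K" "r' \<in> carrier R"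
      by (auto simp: H_def)
    then show "y \<oplus>\<^bsub>M\<^esub> z \<in> H" by (simp add: add HI K)
  next
    fix a y assume "a \<in> carrier R" "y \<in> H"
    then obtain k r where "y = k \<oplus>\<^bsub>M\<^esub> r \<odot>\<^bsub>M\<^esub> x" "k \<in> K" "r \<in> carrier R" "a \<in> carrier R"
      by (auto simp: H_def)
    then show "a \<odot>\<^bsub>M\<^esub> y \<in> H" by (simp add: smult HI K)
  qed
  \<comment> \<open>The coefficient r is any one with y in K + r x; the next fact shows that the
    choice does not affect r u.\<close>
  define f where "f y = (SOME r. r \<in> carrier R \<and> (\<exists>k\<in>K. y = k \<oplus>\<^bsub>M\<^esub> r \<odot>\<^bsub>M\<^esub> x)) \<odot>\<^bsub>E\<^esub> u" for y
  have f: "f (k \<oplus>\<^bsub>M\<^esub> r \<odot>\<^bsub>M\<^esub> x) = r \<odot>\<^bsub>E\<^esub> u" if k: "k \<in> K" and r: "r \<in> carrier R" for k r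
  proof -
    let ?P = "\<lambda>s. s \<in> carrier R \<and> (\<exists>l\<in>K. k \<oplus>\<^bsub>M\<^esub> r \<odot>\<^bsub>M\<^esub> x = l \<oplus>\<^bsub>M\<^esub> s \<odot>\<^bsub>M\<^esub> x)"
    define s where "s = (SOME s. ?P s)"
    have "?P s" unfolding s_def by (rule someI_ex) (use k r in blast)
    then obtain l where s: "s \<in> carrier R" and l: "l \<in> K"
      and eq: "k \<oplus>\<^bsub>M\<^esub> r \<odot>\<^bsub>M\<^esub> x = l \<oplus>\<^bsub>M\<^esub> s \<odot>\<^bsub>M\<^esub> x" by blast
    have car: "k \<in> carrier M" "l \<in> carrier M" "r \<odot>\<^bsub>M\<^esub> x \<in> carrier M" "s \<odot>\<^bsub>M\<^esub> x \<in> carrier M"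
      using k l r s assms(6) K by auto
    \<comment> \<open>The two representations of the same element give (s - r) x = k - l in K, so s
      - r lies in J.\<close>
    have "(s \<ominus>\<^bsub>R\<^esub> r) \<odot>\<^bsub>M\<^esub> x = s \<odot>\<^bsub>M\<^esub> x \<oplus>\<^bsub>M\<^esub> \<ominus>\<^bsub>M\<^esub> (r \<odot>\<^bsub>M\<^esub> x)"
      using r s assms(6) by (simp add: M.R.minus_eq M.smult_l_distr M.smult_l_minus)
    also have "s \<odot>\<^bsub>M\<^esub> x = \<ominus>\<^bsub>M\<^esub> l \<oplus>\<^bsub>M\<^esub> (k \<oplus>\<^bsub>M\<^esub> r \<odot>\<^bsub>M\<^esub> x)"
      unfolding eq using car by (simp add: M.M.r_neg1)
    also have "\<dots> \<oplus>\<^bsub>M\<^esub> \<ominus>\<^bsub>M\<^esub> (r \<odot>\<^bsub>M\<^esub> x) = \<ominus>\<^bsub>M\<^esub> l \<oplus>\<^bsub>M\<^esub> k"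
      using car by (simp add: M.M.a_assoc M.M.r_neg)
    finally have "s \<ominus>\<^bsub>R\<^esub> r \<in> J" using k l r s K by (simp add: J_def)
    then have "(s \<ominus>\<^bsub>R\<^esub> r) \<odot>\<^bsub>E\<^esub> u = \<zero>\<^bsub>E\<^esub>" using J u(3) by blast
    then have "s \<odot>\<^bsub>E\<^esub> u \<ominus>\<^bsub>E\<^esub> r \<odot>\<^bsub>E\<^esub> u = \<zero>\<^bsub>E\<^esub>"
      using r s u(1) by (simp add: M.R.minus_eq E.M.minus_eq E.smult_l_distr E.smult_l_minus)
    then have "s \<odot>\<^bsub>E\<^esub> u = r \<odot>\<^bsub>E\<^esub> u"
      using r s u(1) E.M.minus_equality[of "s \<odot>\<^bsub>E\<^esub> u" "\<ominus>\<^bsub>E\<^esub> (r \<odot>\<^bsub>E\<^esub> u)"]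
      by (simp add: E.M.minus_eq)
    then show ?thesis by (simp add: f_def s_def)
  qed
  let ?H = "M\<lparr>carrier := H\<rparr>"
  have modH: "module R ?H" by (rule submodule.submodule_is_module[OF subH assms(4)])
  interpret H: module R ?H by (rule modH)
  have "(\<lambda>y\<in>carrier ?H. y) \<in> module_homs R ?H M"
    using M.submodule_carrier[OF subH] M.submoduleE(4,5)[OF subH]
    by (intro restrict_in_module_homs) auto
  moreover have "(\<lambda>y\<in>carrier ?H. f y) \<in> module_homs R ?H E"
  proof (intro restrict_in_module_homs)
    fix y assume "y \<in> carrier ?H"
    then obtain k r where y: "y = k \<oplus>\<^bsub>M\<^esub> r \<odot>\<^bsub>M\<^esub> x" "k \<in> K" "r \<in> carrier R"
      by (auto simp: H_def)
    show "f y \<in> carrier E" using y u(1) by (simp add: f)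
    show "f (a \<odot>\<^bsub>?H\<^esub> y) = a \<odot>\<^bsub>E\<^esub> f y" if "a \<in> carrier R" for a
      using y u(1) that K by (simp add: smult f E.smult_assoc1)
    fix z assume "z \<in> carrier ?H"
    then obtain l s where z: "z = l \<oplus>\<^bsub>M\<^esub> s \<odot>\<^bsub>M\<^esub> x" "l \<in> K" "s \<in> carrier R"
      by (auto simp: H_def)
    show "f (y \<oplus>\<^bsub>?H\<^esub> z) = f y \<oplus>\<^bsub>E\<^esub> f z"
      using y z u(1) K by (simp add: add f E.smult_l_distr)
  qed (use M.submoduleE(4,5)[OF subH] in auto)
  moreover have "inj_on (\<lambda>y\<in>carrier ?H. y) (carrier ?H)" by (auto simp: inj_on_def)
  ultimately have "\<exists>g\<in>module_homs R M E. \<forall>y\<in>carrier ?H. g ((\<lambda>y\<in>carrier ?H. y) y) = (\<lambda>y\<in>carrier ?H. f y) y"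
    using injE modH assms(4) unfolding injective_module_def by blast
  then obtain g where g: "g \<in> module_homs R M E" "\<And>y. y \<in> H \<Longrightarrow> g y = f y" by auto
  have gf: "g (k \<oplus>\<^bsub>M\<^esub> r \<odot>\<^bsub>M\<^esub> x) = r \<odot>\<^bsub>E\<^esub> u" if "k \<in> K" "r \<in> carrier R" for k r
    using g(2)[OF HI[OF that]] f[OF that] by simp
  show thesis
  proof (rule that[OF g(1)])
    show "g k = \<zero>\<^bsub>E\<^esub>" if "k \<in> K" for k
      using gf[OF that, of "\<zero>\<^bsub>R\<^esub>"] assms(6) u(1) that K by simp
    show "g x \<noteq> \<zero>\<^bsub>E\<^esub>"
      using gf[of "\<zero>\<^bsub>M\<^esub>" "\<one>\<^bsub>R\<^esub>"] assms(6) u K by simp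
  qed
qed


section \<open>Smile duals\<close>

text \<open>Biduality turns x into evaluation at x, and a functional on D comes from the quotient D
  / \<alpha>(D) exactly when it kills \<alpha>(D). The submodule hypothesis makes this quotient a
  module with its universal property.\<close>

lemma smile_dual_eq_common_kernel:
  assumes "module R M" "module R E" "submodule (\<alpha> (dual R E M)) R (dual R E M)"
  shows "smile_dual R E \<alpha> M = {x \<in> carrier M. \<forall>f\<in>\<alpha> (dual R E M). f x = \<zero>\<^bsub>E\<^esub>}"
proof -
  interpret M: module R M by fact
  define D where "D = dual R E M"
  define K where "K = \<alpha> D"
  let ?Q = "quot_module D K"
  interpret D: module R D
    unfolding D_def dual_def by (rule M.module_hom_module[OF assms(2)])
  have sub: "submodule K R D" using assms(3) by (simp add: K_def D_def)
  have D: "carrier D = module_homs R M E" by (simp add: D_def dual_def hom_module_def)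
  have "bidual_map R E M x \<in> dual_map R E D ?Q (quot_map D K) ` carrier (dual R E ?Q) \<longleftrightarrow>
      (\<forall>f\<in>K. f x = \<zero>\<^bsub>E\<^esub>)" if x: "x \<in> carrier M" for x
  proof
    have ev: "bidual_map R E M x = (\<lambda>f\<in>carrier D. f x)"
      using x by (simp add: bidual_map_def D_def)
    have hom: "(\<lambda>f\<in>carrier D. f x) \<in> module_homs R D E"
    proof (rule restrict_in_module_homs)
      show "(f \<oplus>\<^bsub>D\<^esub> g) x = f x \<oplus>\<^bsub>E\<^esub> g x" for f g
        using x by (simp add: D_def dual_def hom_module_def)
      show "(a \<odot>\<^bsub>D\<^esub> f) x = a \<odot>\<^bsub>E\<^esub> f x" for a f
        using x by (simp add: D_def dual_def hom_module_def)
      show "f x \<in> carrier E" if "f \<in> carrier D" for f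
        using that x by (simp add: D module_homsD(1))
    qed auto
    \<comment> \<open>The dual of the quotient map is composition with it, so its values depend on
      \<open>f\<close> only through the coset of \<open>f\<close>.\<close>
    have dual: "dual_map R E D ?Q (quot_map D K) g = (\<lambda>f\<in>carrier D. g (K +>\<^bsub>D\<^esub> f))"
      if "g \<in> module_homs R ?Q E" for g
      using that by (auto simp: dual_map_def dual_def hom_module_def compose_def quot_map_def)
    show "\<forall>f\<in>K. f x = \<zero>\<^bsub>E\<^esub>"
      if range: "bidual_map R E M x \<in> dual_map R E D ?Q (quot_map D K) ` carrier (dual R E ?Q)"
    proof
      fix f assume f: "f \<in> K"
      obtain g where g: "(\<lambda>f\<in>carrier D. f x) = (\<lambda>f\<in>carrier D. g (K +>\<^bsub>D\<^esub> f))"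
        using range dual by (auto simp: ev dual_def hom_module_def)
      have fD: "f \<in> carrier D" using f D.submodule_carrier[OF sub] by blast
      \<comment> \<open>\<open>f\<close> and the zero functional have the same coset, so
        \<open>g\<close> does not distinguish them and evaluation at x agrees on both.\<close>
      have "K +>\<^bsub>D\<^esub> f = K" "K +>\<^bsub>D\<^esub> \<zero>\<^bsub>D\<^esub> = K"
        using D.coset_eq_self_iff[OF sub] f fD D.submodule_zero[OF sub] by auto
      then have "f x = \<zero>\<^bsub>D\<^esub> x"
        using fun_cong[OF g, of f] fun_cong[OF g, of "\<zero>\<^bsub>D\<^esub>"] fD by simp
      then show "f x = \<zero>\<^bsub>E\<^esub>" using x by (simp add: D_def dual_def hom_module_def)
    qed
    show "bidual_map R E M x \<in> dual_map R E D ?Q (quot_map D K) ` carrier (dual R E ?Q)"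
      if "\<forall>f\<in>K. f x = \<zero>\<^bsub>E\<^esub>"
    proof -
      have "(\<lambda>f\<in>carrier D. f x) k = \<zero>\<^bsub>E\<^esub>" if "k \<in> K" for k
        using that \<open>\<forall>f\<in>K. f x = \<zero>\<^bsub>E\<^esub>\<close> D.submodule_carrier[OF sub] by simp
      then obtain g where g: "g \<in> module_homs R ?Q E"
        "\<And>f. f \<in> carrier D \<Longrightarrow> g (K +>\<^bsub>D\<^esub> f) = (\<lambda>f\<in>carrier D. f x) f"
        using D.hom_factors_through_quot[OF assms(2) sub hom] by metis
      have "bidual_map R E M x = dual_map R E D ?Q (quot_map D K) g"
        unfolding ev dual[OF g(1)] by (rule restrict_ext) (simp add: g(2))
      then show ?thesis using g(1) by (auto simp: dual_def hom_module_def)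
    qed
  qed
  then show ?thesis
    unfolding smile_dual_def Let_def D_def[symmetric] K_def[symmetric] by blast
qed

section \<open>Cyclic modules and their traces\<close>

text \<open>For closure under scalars, commutativity gives b (a y) = a (b y).\<close>

lemma submodule_annihilated:
  assumes "module R N" "J \<subseteq> carrier R"
  shows "submodule {y \<in> carrier N. \<forall>a\<in>J. a \<odot>\<^bsub>N\<^esub> y = \<zero>\<^bsub>N\<^esub>} R N"
proof -
  interpret N: module R N by fact
  show ?thesis
  proof (rule N.submodule_criterion)
    fix a y assume a: "a \<in> carrier R" and y: "y \<in> {y \<in> carrier N. \<forall>a\<in>J. a \<odot>\<^bsub>N\<^esub> y = \<zero>\<^bsub>N\<^esub>}"
    have "b \<odot>\<^bsub>N\<^esub> (a \<odot>\<^bsub>N\<^esub> y) = \<zero>\<^bsub>N\<^esub>" if "b \<in> J" for b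
    proof -
      have b: "b \<in> carrier R" using that assms(2) by blast
      have "b \<odot>\<^bsub>N\<^esub> (a \<odot>\<^bsub>N\<^esub> y) = (b \<otimes>\<^bsub>R\<^esub> a) \<odot>\<^bsub>N\<^esub> y"
        using a b y by (simp add: N.smult_assoc1)
      also have "b \<otimes>\<^bsub>R\<^esub> a = a \<otimes>\<^bsub>R\<^esub> b" by (rule N.R.m_comm[OF b a])
      also have "\<dots> \<odot>\<^bsub>N\<^esub> y = a \<odot>\<^bsub>N\<^esub> (b \<odot>\<^bsub>N\<^esub> y)" using a b y by (simp add: N.smult_assoc1)
      finally show ?thesis using a y that by simp
    qed
    then show "a \<odot>\<^bsub>N\<^esub> y \<in> {y \<in> carrier N. \<forall>a\<in>J. a \<odot>\<^bsub>N\<^esub> y = \<zero>\<^bsub>N\<^esub>}" using a y by simp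
  qed (use assms(2) in \<open>auto simp: N.smult_r_distr\<close>)
qed

lemma carrier_cyclic_module:
  "carrier (cyclic_module R J) = (\<lambda>r. J +>\<^bsub>self_module R\<^esub> r) ` carrier R"
  by (auto simp: cyclic_module_def quot_module_def A_RCOSETS_def' self_module_def)

lemma cyclic_module_smult:
  assumes "cring R" "ideal J R" "a \<in> carrier R" "r \<in> carrier R"
  shows "a \<odot>\<^bsub>cyclic_module R J\<^esub> (J +>\<^bsub>self_module R\<^esub> r) = J +>\<^bsub>self_module R\<^esub> (a \<otimes>\<^bsub>R\<^esub> r)"
proof -
  interpret S: module R "self_module R" by (rule module_self_module[OF assms(1)])
  show ?thesis
    using S.quot_module_smult[OF submodule_self_module[OF assms(1,2)] assms(3), of r] assms(4)
    by (simp add: cyclic_module_def) (simp add: self_module_def)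
qed

lemma cyclic_module_annihilated:
  assumes "cring R" "ideal J R" "a \<in> J" "X \<in> carrier (cyclic_module R J)"
  shows "a \<odot>\<^bsub>cyclic_module R J\<^esub> X = \<zero>\<^bsub>cyclic_module R J\<^esub>"
proof -
  interpret S: module R "self_module R" by (rule module_self_module[OF assms(1)])
  interpret J: ideal J R by fact
  obtain r where r: "r \<in> carrier R" "X = J +>\<^bsub>self_module R\<^esub> r"
    using assms(4) by (auto simp: carrier_cyclic_module)
  have "J +>\<^bsub>self_module R\<^esub> (a \<otimes>\<^bsub>R\<^esub> r) = J"
    using S.coset_eq_self_iff[OF submodule_self_module[OF assms(1,2)], of "a \<otimes>\<^bsub>R\<^esub> r"]
      J.I_r_closed[OF assms(3) r(1)] J.Icarr by (simp add: self_module_def)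
  then show ?thesis
    using cyclic_module_smult[OF assms(1,2) J.Icarr[OF assms(3)] r(1)] r(2)
    by (simp add: cyclic_module_def quot_module_def)
qed

text \<open>The map sending r to r y kills J, hence factors through R/J.\<close>

lemma cyclic_module_homI:
  assumes "module R N" "ideal J R" "y \<in> carrier N" "\<And>a. a \<in> J \<Longrightarrow> a \<odot>\<^bsub>N\<^esub> y = \<zero>\<^bsub>N\<^esub>"
  obtains g where "g \<in> module_homs R (cyclic_module R J) N"
    and "\<And>r. r \<in> carrier R \<Longrightarrow> g (J +>\<^bsub>self_module R\<^esub> r) = r \<odot>\<^bsub>N\<^esub> y"
proof -
  interpret N: module R N by fact
  interpret S: module R "self_module R" by (rule module_self_module[OF N.R.is_cring])
  interpret J: ideal J R by fact
  have car: "carrier (self_module R) = carrier R" by (simp add: self_module_def)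
  have "(\<lambda>r\<in>carrier (self_module R). r \<odot>\<^bsub>N\<^esub> y) \<in> module_homs R (self_module R) N"
    by (rule restrict_in_module_homs)
      (auto simp: self_module_def assms(3) N.smult_l_distr N.smult_assoc1)
  then obtain g where "g \<in> module_homs R (quot_module (self_module R) J) N"
    "\<And>r. r \<in> carrier R \<Longrightarrow> g (J +>\<^bsub>self_module R\<^esub> r) = r \<odot>\<^bsub>N\<^esub> y"
    by (rule S.hom_factors_through_quot[OF assms(1) submodule_self_module[OF N.R.is_cring assms(2)]])
      (auto simp: car assms(4) J.Icarr)
  then show thesis using that by (simp add: cyclic_module_def)
qed

text \<open>J kills R/J and therefore all values of homomorphisms from it; the elements killed by J
  form a submodule, so sums of such values stay inside. Conversely, a single homomorphism, the one
  taking the coset of 1 to y, already puts y in the trace.\<close>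

lemma trace_cyclic_module:
  assumes "module R N" "ideal J R"
  shows "trace_sel R (cyclic_module R J) N = {y \<in> carrier N. \<forall>a\<in>J. a \<odot>\<^bsub>N\<^esub> y = \<zero>\<^bsub>N\<^esub>}"
    (is "_ = ?T")
proof
  interpret N: module R N by fact
  interpret J: ideal J R by fact
  note R = N.R.is_cring
  let ?L = "cyclic_module R J"
  have sub: "submodule ?T R N"
    by (rule submodule_annihilated[OF assms(1)]) (use J.Icarr in blast)
  have T: "f X \<in> ?T" if f: "f \<in> module_homs R ?L N" and X: "X \<in> carrier ?L" for f X
  proof -
    \<comment> \<open>Scaling \<open>X\<close> by 0, an element of J, yields the zero of R/J, and
      linearity sends it to 0.\<close>
    have "f \<zero>\<^bsub>?L\<^esub> = \<zero>\<^bsub>N\<^esub>"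
      using module_homsD(3)[OF f N.R.zero_closed X] module_homsD(1)[OF f X]
        cyclic_module_annihilated[OF R assms(2) J.zero_closed X] by simp
    then have "a \<odot>\<^bsub>N\<^esub> f X = \<zero>\<^bsub>N\<^esub>" if "a \<in> J" for a
      using module_homsD(3)[OF f J.Icarr[OF that] X]
        cyclic_module_annihilated[OF R assms(2) that X] by simp
    then show ?thesis using module_homsD(1)[OF f X] by simp
  qed
  show "trace_sel R ?L N \<subseteq> ?T"
  proof
    fix y assume "y \<in> trace_sel R ?L N"
    then obtain F u where y: "y = finsum N u F" and F: "finite F" "F \<subseteq> module_homs R ?L N"
      and u: "\<forall>f\<in>F. u f \<in> f ` carrier ?L" by (auto simp: trace_sel_def)
    have "\<forall>f\<in>F. u f \<in> ?T"
    proof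
      fix f assume f: "f \<in> F"
      then obtain X where "X \<in> carrier ?L" "u f = f X" using u by blast
      then show "u f \<in> ?T" using T[of f X] f F(2) by auto
    qed
    with F(1) have "finsum N u F \<in> ?T"
    proof (induction F)
      case empty
      then show ?case using N.submodule_zero[OF sub] by simp
    next
      case (insert f F)
      then have "finsum N u (insert f F) = u f \<oplus>\<^bsub>N\<^esub> finsum N u F"
        by (intro N.M.finsum_insert) auto
      then show ?case using N.submoduleE(5)[OF sub] insert by simp
    qed
    then show "y \<in> ?T" using y by simp
  qed
  show "?T \<subseteq> trace_sel R ?L N"
  proof
    fix y assume y: "y \<in> ?T"
    then obtain g where g: "g \<in> module_homs R ?L N"
      "\<And>r. r \<in> carrier R \<Longrightarrow> g (J +>\<^bsub>self_module R\<^esub> r) = r \<odot>\<^bsub>N\<^esub> y"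
      using cyclic_module_homI[OF assms, of y] by blast
    have "y = g (J +>\<^bsub>self_module R\<^esub> \<one>\<^bsub>R\<^esub>)" using g(2) y by simp
    then have "y \<in> g ` carrier ?L" by (auto simp: carrier_cyclic_module)
    moreover have "y = finsum N (\<lambda>_. y) {g}" using y by simp
    ultimately show "y \<in> trace_sel R ?L N"
      using g(1) unfolding trace_sel_def by (intro CollectI exI[of _ "{g}"] exI[of _ "\<lambda>_. y"]) simp
  qed
qed


section \<open>Tensor products\<close>

lemma module_free_module:
  assumes "cring R"
  shows "module R (free_module R S)"
proof -
  interpret cring R by fact
  have sum: "finite {p. c p \<oplus>\<^bsub>R\<^esub> d p \<noteq> \<zero>\<^bsub>R\<^esub>}"
    if "finite {p. c p \<noteq> \<zero>\<^bsub>R\<^esub>}" "finite {p. d p \<noteq> \<zero>\<^bsub>R\<^esub>}" for c d :: "_ \<Rightarrow> 'a"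
    by (rule finite_subset[OF _ finite_UnI[OF that]]) auto
  have mult: "finite {p. a \<otimes>\<^bsub>R\<^esub> c p \<noteq> \<zero>\<^bsub>R\<^esub>}"
    if "a \<in> carrier R" "finite {p. c p \<noteq> \<zero>\<^bsub>R\<^esub>}" for a and c :: "_ \<Rightarrow> 'a"
    by (rule finite_subset[OF _ that(2)]) (use that(1) in auto)
  show ?thesis
  proof (rule moduleI)
    show "abelian_group (free_module R S)"
    proof (rule abelian_groupI)
      fix c assume c: "c \<in> carrier (free_module R S)"
      show "\<exists>d\<in>carrier (free_module R S). d \<oplus>\<^bsub>free_module R S\<^esub> c = \<zero>\<^bsub>free_module R S\<^esub>"
        using c mult[of "\<ominus>\<^bsub>R\<^esub> \<one>\<^bsub>R\<^esub>" c]
        by (intro bexI[of _ "\<lambda>p. (\<ominus>\<^bsub>R\<^esub> \<one>\<^bsub>R\<^esub>) \<otimes>\<^bsub>R\<^esub> c p"]) (auto simp: free_module_def l_minus l_neg)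
    qed (auto simp: free_module_def sum a_ac)
  qed (auto simp: free_module_def sum mult assms l_distr r_distr m_assoc)
qed

lemma free_gen_carrier:
  assumes "cring R" "p \<in> S"
  shows "free_gen R p \<in> carrier (free_module R S)"
proof -
  interpret cring R by fact
  have "finite {q. free_gen R p q \<noteq> \<zero>\<^bsub>R\<^esub>}"
    by (rule finite_subset[of _ "{p}"]) (auto simp: free_gen_def)
  then show ?thesis using assms(2) by (auto simp: free_module_def free_gen_def)
qed

text \<open>\<Phi> sends a coefficient function to the linear combination of the \<phi> p with those
  coefficients, summed over its support.\<close>

lemma free_module_extend:
  assumes "module R N" "\<And>p. p \<in> S \<Longrightarrow> \<phi> p \<in> carrier N"
  obtains \<Phi> where "\<Phi> \<in> module_homs R (free_module R S) N"
    and "\<And>p. p \<in> S \<Longrightarrow> \<Phi> (free_gen R p) = \<phi> p"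
proof -
  interpret N: module R N by fact
  let ?F = "free_module R S"
  interpret F: module R ?F by (rule module_free_module[OF N.R.is_cring])
  define \<Phi> where "\<Phi> c = finsum N (\<lambda>p. c p \<odot>\<^bsub>N\<^esub> \<phi> p) {p. c p \<noteq> \<zero>\<^bsub>R\<^esub>}" for c
  have F: "c p \<in> carrier R" "finite {p. c p \<noteq> \<zero>\<^bsub>R\<^esub>}" "{p. c p \<noteq> \<zero>\<^bsub>R\<^esub>} \<subseteq> S"
    if "c \<in> carrier ?F" for c p
    using that by (auto simp: free_module_def)
  \<comment> \<open>Supports vary under addition and scaling. Padding the index set by zero
    coefficients leaves the sum unchanged, so all terms of a linearity identity can be summed over
    one common set.\<close>
  have eq: "\<Phi> c = finsum N (\<lambda>p. c p \<odot>\<^bsub>N\<^esub> \<phi> p) A"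
    if "c \<in> carrier ?F" "finite A" "A \<subseteq> S" "{p. c p \<noteq> \<zero>\<^bsub>R\<^esub>} \<subseteq> A" for c A
    unfolding \<Phi>_def using that F(1)[OF that(1)] assms(2)
    by (intro N.M.add.finprod_mono_neutral_cong_left) (auto simp: subset_iff)
  have "(\<lambda>c\<in>carrier ?F. \<Phi> c) \<in> module_homs R ?F N"
  proof (rule restrict_in_module_homs)
    fix c assume c: "c \<in> carrier ?F"
    have car: "c p \<odot>\<^bsub>N\<^esub> \<phi> p \<in> carrier N" if "p \<in> S" for p
      using F(1)[OF c] assms(2) that by simp
    show "\<Phi> c \<in> carrier N"
      unfolding \<Phi>_def using F(3)[OF c] car by (intro N.M.finsum_closed) auto
    show "\<Phi> (a \<odot>\<^bsub>?F\<^esub> c) = a \<odot>\<^bsub>N\<^esub> \<Phi> c" if a: "a \<in> carrier R" for a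
    proof -
      \<comment> \<open>Multiplication by a may shrink the support, so both sides are summed over
        the support of c.\<close>
      let ?A = "{p. c p \<noteq> \<zero>\<^bsub>R\<^esub>}"
      have "\<Phi> (a \<odot>\<^bsub>?F\<^esub> c) = finsum N (\<lambda>p. (a \<odot>\<^bsub>?F\<^esub> c) p \<odot>\<^bsub>N\<^esub> \<phi> p) ?A"
        using F[OF c] F.smult_closed[OF a c] a by (intro eq) (auto simp: free_module_def)
      also have "\<dots> = finsum N (\<lambda>p. a \<odot>\<^bsub>N\<^esub> (c p \<odot>\<^bsub>N\<^esub> \<phi> p)) ?A"
        using F(1,3)[OF c] a assms(2)
        by (intro N.M.finsum_cong') (auto simp: free_module_def N.smult_assoc1 subset_iff)
      also have "\<dots> = a \<odot>\<^bsub>N\<^esub> \<Phi> c"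
        unfolding \<Phi>_def using F(2,3)[OF c] a car
        by (intro N.finsum_smult_ldistr[symmetric]) auto
      finally show ?thesis .
    qed
    fix d assume d: "d \<in> carrier ?F"
    let ?A = "{p. c p \<noteq> \<zero>\<^bsub>R\<^esub>} \<union> {p. d p \<noteq> \<zero>\<^bsub>R\<^esub>}"
    have A: "finite ?A" "?A \<subseteq> S" using F(2,3)[OF c] F(2,3)[OF d] by auto
    have card: "d p \<odot>\<^bsub>N\<^esub> \<phi> p \<in> carrier N" if "p \<in> S" for p
      using F(1)[OF d] assms(2) that by simp
    have "\<Phi> (c \<oplus>\<^bsub>?F\<^esub> d) = finsum N (\<lambda>p. (c \<oplus>\<^bsub>?F\<^esub> d) p \<odot>\<^bsub>N\<^esub> \<phi> p) ?A"
      using A F.M.a_closed[OF c d] by (intro eq) (auto simp: free_module_def)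
    also have "\<dots> = finsum N (\<lambda>p. c p \<odot>\<^bsub>N\<^esub> \<phi> p \<oplus>\<^bsub>N\<^esub> d p \<odot>\<^bsub>N\<^esub> \<phi> p) ?A"
      using F(1)[OF c] F(1)[OF d] A(2) assms(2)
      by (intro N.M.finsum_cong') (auto simp: free_module_def N.smult_l_distr subset_iff)
    also have "\<dots> = finsum N (\<lambda>p. c p \<odot>\<^bsub>N\<^esub> \<phi> p) ?A \<oplus>\<^bsub>N\<^esub> finsum N (\<lambda>p. d p \<odot>\<^bsub>N\<^esub> \<phi> p) ?A"
      using A(2) car card by (intro N.M.finsum_addf) auto
    also have "\<dots> = \<Phi> c \<oplus>\<^bsub>N\<^esub> \<Phi> d" using A c d by (simp add: eq[of _ ?A])
    finally show "\<Phi> (c \<oplus>\<^bsub>?F\<^esub> d) = \<Phi> c \<oplus>\<^bsub>N\<^esub> \<Phi> d" .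
  qed auto
  moreover have "\<Phi> (free_gen R p) = \<phi> p" if p: "p \<in> S" for p
  proof -
    have "\<Phi> (free_gen R p) = finsum N (\<lambda>q. free_gen R p q \<odot>\<^bsub>N\<^esub> \<phi> q) {p}"
      using p by (intro eq free_gen_carrier N.R.is_cring) (auto simp: free_gen_def)
    then show ?thesis using p assms(2) by (simp add: free_gen_def)
  qed
  ultimately show thesis
    by (intro that[of "restrict \<Phi> (carrier ?F)"]) (auto simp: free_gen_carrier N.R.is_cring)
qed

section \<open>Vanishing of pure tensors, computed in the free module\<close>

context
  fixes R :: "('a, 'r) ring_scheme" and L :: "('a, 'l, 'x) module_scheme"
    and N :: "('a, 'n) module"
  assumes L: "module R L" and N: "module R N"
begin

interpretation L: module R L by (rule L)
interpretation N: module R N by (rule N)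

abbreviation "tensor_free \<equiv> free_module R (carrier L \<times> carrier N)"

abbreviation "tensor_span \<equiv> submodule_span R tensor_free (tensor_relations R L N)"

interpretation F: module R tensor_free by (rule module_free_module[OF L.R.is_cring])

lemma free_gen_tensor_carrier:
  "x \<in> carrier L \<Longrightarrow> z \<in> carrier N \<Longrightarrow> free_gen R (x, z) \<in> carrier tensor_free"
  by (simp add: free_gen_carrier L.R.is_cring)

lemma tensor_relations_subset: "tensor_relations R L N \<subseteq> carrier tensor_free"
  unfolding tensor_relations_def Let_def by (auto simp: free_gen_tensor_carrier)

lemma submodule_tensor_span: "submodule tensor_span R tensor_free"
  by (rule F.submodule_submodule_span[OF tensor_relations_subset])

text \<open>A coset is the zero of the quotient exactly when its representative lies in the
  submodule. From here on, statements about tensors become membership questions in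
  \<open>tensor_span\<close>.\<close>

lemma pure_tensor_eq_zero_iff:
  assumes "x \<in> carrier L" "z \<in> carrier N"
  shows "pure_tensor R L N x z = \<zero>\<^bsub>tensor_product R L N\<^esub> \<longleftrightarrow> free_gen R (x, z) \<in> tensor_span"
  using assms F.coset_eq_self_iff[OF submodule_tensor_span]
  by (simp add: pure_tensor_def tensor_product_def Let_def quot_map_def quot_module_def
      free_gen_tensor_carrier)

text \<open>Every defining relation is a difference of two terms; modulo the span either term may
  replace the other.\<close>

lemma tensor_span_cong:
  assumes "u \<ominus>\<^bsub>tensor_free\<^esub> v \<in> tensor_relations R L N"
    and "u \<in> carrier tensor_free" "v \<in> carrier tensor_free"
  shows "u \<in> tensor_span \<longleftrightarrow> v \<in> tensor_span"
proof -
  note sub = F.submoduleE(3,5)[OF submodule_tensor_span]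
  have d: "u \<ominus>\<^bsub>tensor_free\<^esub> v \<in> tensor_span"
    using assms(1) F.submodule_span_superset by blast
  have u: "(u \<ominus>\<^bsub>tensor_free\<^esub> v) \<oplus>\<^bsub>tensor_free\<^esub> v = u"
    using assms(2,3) by (simp add: F.M.minus_eq F.M.a_assoc F.M.l_neg)
  moreover have "\<ominus>\<^bsub>tensor_free\<^esub> (u \<ominus>\<^bsub>tensor_free\<^esub> v) \<oplus>\<^bsub>tensor_free\<^esub> u = v"
    using F.M.r_neg1[of "u \<ominus>\<^bsub>tensor_free\<^esub> v" v] assms(2,3) unfolding u by simp
  ultimately show ?thesis using sub d by metis
qed

text \<open>Together with its right-hand counterpart this moves a scalar across the tensor sign,
  with the multiple of the generator as the common middle term.\<close>

lemma free_gen_smult_left_in_span_iff: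
  assumes "a \<in> carrier R" "x \<in> carrier L" "z \<in> carrier N"
  shows "free_gen R (a \<odot>\<^bsub>L\<^esub> x, z) \<in> tensor_span \<longleftrightarrow>
    a \<odot>\<^bsub>tensor_free\<^esub> free_gen R (x, z) \<in> tensor_span"
  by (rule tensor_span_cong)
    (use assms in \<open>auto simp: tensor_relations_def Let_def intro: free_gen_tensor_carrier\<close>)

lemma free_gen_smult_right_in_span_iff:
  assumes "a \<in> carrier R" "x \<in> carrier L" "z \<in> carrier N"
  shows "free_gen R (x, a \<odot>\<^bsub>N\<^esub> z) \<in> tensor_span \<longleftrightarrow>
    a \<odot>\<^bsub>tensor_free\<^esub> free_gen R (x, z) \<in> tensor_span"
  by (rule tensor_span_cong)
    (use assms in \<open>auto simp: tensor_relations_def Let_def intro: free_gen_tensor_carrier\<close>)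

lemma free_gen_add_right_in_span:
  assumes "x \<in> carrier L" "z \<in> carrier N" "w \<in> carrier N"
    and "free_gen R (x, z) \<in> tensor_span" "free_gen R (x, w) \<in> tensor_span"
  shows "free_gen R (x, z \<oplus>\<^bsub>N\<^esub> w) \<in> tensor_span"
proof -
  have "free_gen R (x, z \<oplus>\<^bsub>N\<^esub> w) \<in> tensor_span \<longleftrightarrow>
      free_gen R (x, z) \<oplus>\<^bsub>tensor_free\<^esub> free_gen R (x, w) \<in> tensor_span"
    by (rule tensor_span_cong)
      (use assms in \<open>auto simp: tensor_relations_def Let_def intro: free_gen_tensor_carrier\<close>)
  then show ?thesis using F.submoduleE(5)[OF submodule_tensor_span] assms by simp
qed

lemma tom_sel_iff:
  "z \<in> tom_sel R L N \<longleftrightarrow> z \<in> carrier N \<and> (\<forall>x\<in>carrier L. free_gen R (x, z) \<in> tensor_span)"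
  using pure_tensor_eq_zero_iff unfolding tom_sel_def by blast

lemma submodule_tom_sel: "submodule (tom_sel R L N) R N"
proof (rule N.submodule_criterion)
  \<comment> \<open>Since 0 = 0 0 in N, the scalar relation reduces the generator at (x, 0) to 0
    times a generator, the zero of the free module.\<close>
  show "\<zero>\<^bsub>N\<^esub> \<in> tom_sel R L N"
    using free_gen_smult_right_in_span_iff[of "\<zero>\<^bsub>R\<^esub>" _ "\<zero>\<^bsub>N\<^esub>"]
      F.submodule_zero[OF submodule_tensor_span]
    by (auto simp: tom_sel_iff free_gen_tensor_carrier)
qed (auto simp: tom_sel_iff free_gen_add_right_in_span free_gen_smult_right_in_span_iff
    F.submoduleE(4)[OF submodule_tensor_span])

text \<open>In tensor notation, x \<otimes> a z = a x \<otimes> z = 0 \<otimes> z = 0 for a in J,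
  and \<open>tom_sel\<close> is a submodule, so the generators of JN suffice.\<close>

lemma ideal_smult_subset_tom_sel:
  assumes "J \<subseteq> carrier R" "\<And>a x. a \<in> J \<Longrightarrow> x \<in> carrier L \<Longrightarrow> a \<odot>\<^bsub>L\<^esub> x = \<zero>\<^bsub>L\<^esub>"
  shows "ideal_smult R J N \<subseteq> tom_sel R L N"
  unfolding ideal_smult_def
proof (rule N.submodule_span_least[OF submodule_tom_sel], clarify)
  fix a z assume a: "a \<in> J" and z: "z \<in> carrier N"
  have aR: "a \<in> carrier R" using a assms(1) by blast
  have "free_gen R (x, a \<odot>\<^bsub>N\<^esub> z) \<in> tensor_span" if x: "x \<in> carrier L" for x
  proof -
    have "free_gen R (\<zero>\<^bsub>L\<^esub>, z) \<in> tensor_span"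
      using free_gen_smult_left_in_span_iff[of "\<zero>\<^bsub>R\<^esub>" "\<zero>\<^bsub>L\<^esub>" z] z
        F.submodule_zero[OF submodule_tensor_span] by (simp add: free_gen_tensor_carrier)
    then show ?thesis
      using free_gen_smult_left_in_span_iff[OF aR x z]
        free_gen_smult_right_in_span_iff[OF aR x z] assms(2)[OF a x] by simp
  qed
  then show "a \<odot>\<^bsub>N\<^esub> z \<in> tom_sel R L N" using aR z by (simp add: tom_sel_iff)
qed

text \<open>The linear extension of \<phi> to the free module kills the relations by bilinearity,
  hence their span, which contains the generator of a vanishing pure tensor. Its contrapositive
  certifies that a tensor is nonzero.\<close>

lemma bilinear_vanishes_if_pure_tensor_zero:
  assumes "module R P"
    and "\<And>x z. x \<in> carrier L \<Longrightarrow> z \<in> carrier N \<Longrightarrow> \<phi> x z \<in> carrier P"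
    and "\<And>x y z. x \<in> carrier L \<Longrightarrow> y \<in> carrier L \<Longrightarrow> z \<in> carrier N \<Longrightarrow>
      \<phi> (x \<oplus>\<^bsub>L\<^esub> y) z = \<phi> x z \<oplus>\<^bsub>P\<^esub> \<phi> y z"
    and "\<And>x z w. x \<in> carrier L \<Longrightarrow> z \<in> carrier N \<Longrightarrow> w \<in> carrier N \<Longrightarrow>
      \<phi> x (z \<oplus>\<^bsub>N\<^esub> w) = \<phi> x z \<oplus>\<^bsub>P\<^esub> \<phi> x w"
    and "\<And>a x z. a \<in> carrier R \<Longrightarrow> x \<in> carrier L \<Longrightarrow> z \<in> carrier N \<Longrightarrow>
      \<phi> (a \<odot>\<^bsub>L\<^esub> x) z = a \<odot>\<^bsub>P\<^esub> \<phi> x z"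
    and "\<And>a x z. a \<in> carrier R \<Longrightarrow> x \<in> carrier L \<Longrightarrow> z \<in> carrier N \<Longrightarrow>
      \<phi> x (a \<odot>\<^bsub>N\<^esub> z) = a \<odot>\<^bsub>P\<^esub> \<phi> x z"
    and "x \<in> carrier L" "z \<in> carrier N" "pure_tensor R L N x z = \<zero>\<^bsub>tensor_product R L N\<^esub>"
  shows "\<phi> x z = \<zero>\<^bsub>P\<^esub>"
proof -
  interpret P: module R P by fact
  obtain \<Phi> where \<Phi>: "\<Phi> \<in> module_homs R tensor_free P"
    and gen': "\<And>p. p \<in> carrier L \<times> carrier N \<Longrightarrow> \<Phi> (free_gen R p) = (case p of (x, z) \<Rightarrow> \<phi> x z)"
    by (rule free_module_extend[OF assms(1), of "carrier L \<times> carrier N" "\<lambda>(x, z). \<phi> x z"])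
      (use assms(2) in auto)
  have gen: "\<Phi> (free_gen R (x, z)) = \<phi> x z" if "x \<in> carrier L" "z \<in> carrier N" for x z
    using gen' that by simp
  \<comment> \<open>Relations are differences, so it suffices that \<Phi> agrees on the two
    terms.\<close>
  have diff: "u \<ominus>\<^bsub>tensor_free\<^esub> v \<in> {c \<in> carrier tensor_free. \<Phi> c = \<zero>\<^bsub>P\<^esub>}"
    if "u \<in> carrier tensor_free" "v \<in> carrier tensor_free" "\<Phi> u = \<Phi> v" for u v
  proof -
    have "\<Phi> u = \<Phi> ((u \<ominus>\<^bsub>tensor_free\<^esub> v) \<oplus>\<^bsub>tensor_free\<^esub> v)"
      using that by (simp add: F.M.minus_eq F.M.a_assoc F.M.l_neg)
    also have "\<dots> = \<Phi> (u \<ominus>\<^bsub>tensor_free\<^esub> v) \<oplus>\<^bsub>P\<^esub> \<Phi> v"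
      using that by (intro module_homsD(2)[OF \<Phi>]) auto
    finally show ?thesis
      using that module_homsD(1)[OF \<Phi>] P.M.add.r_cancel_one' by simp
  qed
  have "tensor_relations R L N \<subseteq> {c \<in> carrier tensor_free. \<Phi> c = \<zero>\<^bsub>P\<^esub>}"
    unfolding tensor_relations_def Let_def
  \<comment> \<open>The elimination separates the four families of relations; \<open>diff\<close>
    then asks for membership of both terms and equality of their images, which is bilinearity of
    \<phi>.\<close>
  proof (intro Un_least subsetI; elim CollectE exE conjE; hypsubst; intro diff)
  qed (simp_all add: free_gen_tensor_carrier module_homsD[OF \<Phi>] gen assms(3-6))
  from F.submodule_span_least[OF F.submodule_kernel[OF assms(1) \<Phi>] this]
  have "free_gen R (x, z) \<in> {c \<in> carrier tensor_free. \<Phi> c = \<zero>\<^bsub>P\<^esub>}"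
    using assms(9) pure_tensor_eq_zero_iff[OF assms(7,8)] by (auto dest: subsetD)
  then show ?thesis using gen[OF assms(7,8)] by simp
qed

end

text \<open>JM is the kernel of M -> M/JM, which is R/J \<otimes> M. Instead of constructing that
  isomorphism, the harder inclusion tests an element outside JM with a functional that kills
  JM.\<close>

lemma tom_cyclic_module:
  fixes M :: "('a, 'm) module"
  assumes "noetherian_ring R" "local_ring R" "injective_hull R (residue_field R) E"
    and "module R M" "ideal J R"
  shows "tom_sel R (cyclic_module R J) M = ideal_smult R J M"
proof
  interpret M: module R M by fact
  interpret E: module R E using assms(3) by (simp add: injective_hull_def injective_module_def)
  interpret J: ideal J R by fact
  let ?L = "cyclic_module R J"
  let ?q = "\<lambda>r. J +>\<^bsub>self_module R\<^esub> r"
  note R = M.R.is_cring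
  interpret S: module R "self_module R" by (rule module_self_module[OF R])
  have L: "module R ?L"
    unfolding cyclic_module_def
    by (rule S.module_quot_module[OF submodule_self_module[OF R assms(5)]])
  interpret L: module R ?L by (rule L)
  have JR: "J \<subseteq> carrier R" using J.Icarr by blast
  show "ideal_smult R J M \<subseteq> tom_sel R ?L M"
    by (rule ideal_smult_subset_tom_sel[OF L assms(4) JR])
      (rule cyclic_module_annihilated[OF R assms(5)])
  show "tom_sel R ?L M \<subseteq> ideal_smult R J M"
  proof (rule subsetI, rule ccontr)
    fix x assume x: "x \<in> tom_sel R ?L M" "x \<notin> ideal_smult R J M"
    have xM: "x \<in> carrier M" using x(1) by (simp add: tom_sel_def)
    obtain f where f: "f \<in> module_homs R M E" "f x \<noteq> \<zero>\<^bsub>E\<^esub>"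
      and fJ: "\<forall>k\<in>ideal_smult R J M. f k = \<zero>\<^bsub>E\<^esub>"
      by (rule injective_hull_separates_points[OF assms(1-4) M.submodule_ideal_smult[OF JR] xM x(2)])
        blast
    note fD = module_homsD[OF f(1)]
    \<comment> \<open>For each z a homomorphism from R/J taking the coset of 1 to f(z); it exists
      because \<open>f\<close> vanishes on JM and so J kills f(z).\<close>
    have "\<exists>g. g \<in> module_homs R ?L E \<and> (\<forall>r\<in>carrier R. g (?q r) = r \<odot>\<^bsub>E\<^esub> f z)"
      if z: "z \<in> carrier M" for z
    proof (rule cyclic_module_homI[OF E.module_axioms assms(5) fD(1)[OF z]])
      show "a \<odot>\<^bsub>E\<^esub> f z = \<zero>\<^bsub>E\<^esub>" if "a \<in> J" for a
        using fJ z that M.hom_vanishes_on_ideal_smult_iff[OF E.module_axioms f(1) JR] by blast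
    qed blast
    then obtain g where g: "\<And>z. z \<in> carrier M \<Longrightarrow> g z \<in> module_homs R ?L E"
      and gq: "\<And>z r. z \<in> carrier M \<Longrightarrow> r \<in> carrier R \<Longrightarrow> g z (?q r) = r \<odot>\<^bsub>E\<^esub> f z"
      by metis
    \<comment> \<open>The pairing of (X, z) to \<open>g z X\<close> is bilinear: linear in X by
      choice of \<open>g z\<close>, linear in z by linearity of \<open>f\<close>. Its value at the
      coset of 1 and x is f(x), which contradicts f(x) \<noteq> 0.\<close>
    have "g x (?q \<one>\<^bsub>R\<^esub>) = \<zero>\<^bsub>E\<^esub>"
    proof (rule bilinear_vanishes_if_pure_tensor_zero[OF L assms(4) E.module_axioms,
          where \<phi> = "\<lambda>X z. g z X"])
      show "?q \<one>\<^bsub>R\<^esub> \<in> carrier ?L" by (auto simp: carrier_cyclic_module)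
      then show "pure_tensor R ?L M (?q \<one>\<^bsub>R\<^esub>) x = \<zero>\<^bsub>tensor_product R ?L M\<^esub>"
        using x(1) by (simp add: tom_sel_def)
    next
      fix X z w assume "X \<in> carrier ?L" "z \<in> carrier M" "w \<in> carrier M"
      then show "g (z \<oplus>\<^bsub>M\<^esub> w) X = g z X \<oplus>\<^bsub>E\<^esub> g w X"
        by (auto simp: carrier_cyclic_module gq fD E.smult_r_distr)
    next
      fix a X z assume "a \<in> carrier R" "X \<in> carrier ?L" "z \<in> carrier M"
      then show "g (a \<odot>\<^bsub>M\<^esub> z) X = a \<odot>\<^bsub>E\<^esub> g z X"
        by (auto simp: carrier_cyclic_module gq fD M.R.m_comm simp flip: E.smult_assoc1)
    qed (use module_homsD[OF g] xM in auto)
    then show False using f(2) gq[OF xM] fD(1)[OF xM] by simp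
  qed
qed


text \<open>The functionals killed by J are those vanishing on JM, and their common kernel is JM
  because functionals separate points from submodules. Only the value of \<alpha> on the dual is
  prescribed, which is what the smile dual sees.\<close>

lemma smile_dual_annihilated:
  fixes M :: "('a, 'm) module"
  assumes "noetherian_ring R" "local_ring R" "injective_hull R (residue_field R) E"
    and "module R M" "ideal J R"
    and \<alpha>: "\<alpha> (dual R E M) =
      {f \<in> carrier (dual R E M). \<forall>a\<in>J. a \<odot>\<^bsub>dual R E M\<^esub> f = \<zero>\<^bsub>dual R E M\<^esub>}"
  shows "smile_dual R E \<alpha> M = ideal_smult R J M"
proof -
  interpret M: module R M by fact
  interpret E: module R E using assms(3) by (simp add: injective_hull_def injective_module_def)
  interpret J: ideal J R by fact
  let ?D = "dual R E M"
  have JR: "J \<subseteq> carrier R" using J.Icarr by blast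
  have "module R ?D"
    unfolding dual_def by (rule M.module_hom_module[OF E.module_axioms])
  then have "submodule (\<alpha> ?D) R ?D" unfolding \<alpha> by (rule submodule_annihilated[OF _ JR])
  then have smile: "smile_dual R E \<alpha> M = {x \<in> carrier M. \<forall>f\<in>\<alpha> ?D. f x = \<zero>\<^bsub>E\<^esub>}"
    by (rule smile_dual_eq_common_kernel[OF assms(4) E.module_axioms])
  have mem: "f \<in> \<alpha> ?D \<longleftrightarrow> f \<in> module_homs R M E \<and> (\<forall>z\<in>ideal_smult R J M. f z = \<zero>\<^bsub>E\<^esub>)" for f
  proof (cases "f \<in> module_homs R M E")
    case True
    \<comment> \<open>Scalars act pointwise on functionals, so annihilation in the dual becomes the
      right-hand condition of \<open>hom_vanishes_on_ideal_smult_iff\<close>.\<close>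
    have "a \<odot>\<^bsub>?D\<^esub> f = \<zero>\<^bsub>?D\<^esub> \<longleftrightarrow> (\<forall>x\<in>carrier M. a \<odot>\<^bsub>E\<^esub> f x = \<zero>\<^bsub>E\<^esub>)" for a
      by (auto simp: dual_def hom_module_def fun_eq_iff restrict_def)
    then show ?thesis
      using True M.hom_vanishes_on_ideal_smult_iff[OF E.module_axioms True JR]
      by (simp add: \<alpha>) (simp add: dual_def hom_module_def)
  qed (simp add: \<alpha>, simp add: dual_def hom_module_def)
  show ?thesis
  proof
    show "ideal_smult R J M \<subseteq> smile_dual R E \<alpha> M"
      using M.submodule_carrier[OF M.submodule_ideal_smult[OF JR]] by (auto simp: smile mem)
    show "smile_dual R E \<alpha> M \<subseteq> ideal_smult R J M"
    proof (rule subsetI, rule ccontr)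
      fix x assume x: "x \<in> smile_dual R E \<alpha> M" "x \<notin> ideal_smult R J M"
      have xM: "x \<in> carrier M" using x(1) by (simp add: smile)
      obtain f where f: "f \<in> module_homs R M E" "f x \<noteq> \<zero>\<^bsub>E\<^esub>"
        and "\<forall>k\<in>ideal_smult R J M. f k = \<zero>\<^bsub>E\<^esub>"
        by (rule injective_hull_separates_points[OF assms(1-4) M.submodule_ideal_smult[OF JR] xM x(2)])
          blast
      then have "f \<in> \<alpha> ?D" by (simp add: mem)
      then show False using x(1) f(2) by (simp add: smile)
    qed
  qed
qed

section \<open>Powers of an ideal and the limits\<close>

lemma ideal_ideal_pow:
  assumes "cring R" "ideal I R"
  shows "ideal (ideal_pow R I n) R"
proof -
  interpret cring R by fact
  show ?thesis by (induction n) (auto simp: oneideal ideal_prod_is_ideal assms(2))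
qed

lemma ideal_pow_antimono:
  assumes "cring R" "ideal I R" "m \<le> n"
  shows "ideal_pow R I n \<subseteq> ideal_pow R I m"
  using assms(3)
proof (induction rule: dec_induct)
  case (step k)
  interpret cring R by fact
  \<comment> \<open>A product of ideals lies in each factor, so the next power lies in the current
    one.\<close>
  show ?case
    using ideal_prod_inter[OF assms(2) ideal_ideal_pow[OF assms(1,2), of k]] step by auto
qed simp

text \<open>This allows two selectors to be compared on the dual of M alone.\<close>

lemma smile_dual_cong: "\<alpha> (dual R E M) = \<beta> (dual R E M) \<Longrightarrow> smile_dual R E \<alpha> M = smile_dual R E \<beta> M"
  by (simp add: smile_dual_def)

text \<open>The common kernel of a union of sets of functionals is the intersection of their common
  kernels. Monotonicity makes the union a submodule, as \<open>smile_dual_eq_common_kernel\<close>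
  requires.\<close>

lemma smile_dual_direct_limit:
  assumes "module R M" "module R E"
    and sub: "\<And>n. submodule (s n (dual R E M)) R (dual R E M)"
    and mono: "\<And>m n. m \<le> n \<Longrightarrow> s m (dual R E M) \<subseteq> s n (dual R E M)"
  shows "smile_dual R E (direct_limit_sel s) M = inverse_limit_sel (\<lambda>n. smile_dual R E (s n)) M"
proof -
  interpret M: module R M by fact
  let ?D = "dual R E M"
  interpret D: module R ?D
    unfolding dual_def by (rule M.module_hom_module[OF assms(2)])
  have "submodule (direct_limit_sel s ?D) R ?D"
  proof (rule D.submodule_criterion)
    fix f g assume "f \<in> direct_limit_sel s ?D" "g \<in> direct_limit_sel s ?D"
    then obtain m n where "f \<in> s m ?D" "g \<in> s n ?D" by (auto simp: direct_limit_sel_def)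
    \<comment> \<open>Directedness: both summands are moved to the later index, where the sum can be
      formed.\<close>
    then have "f \<in> s (max m n) ?D" "g \<in> s (max m n) ?D"
      using mono[of m "max m n"] mono[of n "max m n"] by auto
    then show "f \<oplus>\<^bsub>?D\<^esub> g \<in> direct_limit_sel s ?D"
      using D.submoduleE(5)[OF sub] by (auto simp: direct_limit_sel_def)
  next
    show "direct_limit_sel s ?D \<subseteq> carrier ?D"
      using D.submodule_carrier[OF sub] by (auto simp: direct_limit_sel_def)
    show "\<zero>\<^bsub>?D\<^esub> \<in> direct_limit_sel s ?D"
      using D.submodule_zero[OF sub] by (simp add: direct_limit_sel_def)
  next
    fix a f assume "a \<in> carrier R" "f \<in> direct_limit_sel s ?D"
    then show "a \<odot>\<^bsub>?D\<^esub> f \<in> direct_limit_sel s ?D"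
      using D.submoduleE(4)[OF sub] unfolding direct_limit_sel_def by blast
  qed
  then have "smile_dual R E (direct_limit_sel s) M =
      {x \<in> carrier M. \<forall>f\<in>direct_limit_sel s ?D. f x = \<zero>\<^bsub>E\<^esub>}"
    by (rule smile_dual_eq_common_kernel[OF assms(1,2)])
  moreover have "smile_dual R E (s n) M = {x \<in> carrier M. \<forall>f\<in>s n ?D. f x = \<zero>\<^bsub>E\<^esub>}" for n
    by (rule smile_dual_eq_common_kernel[OF assms(1,2)]) (rule sub)
  ultimately show ?thesis by (auto simp: inverse_limit_sel_def direct_limit_sel_def)
qed

text \<open>x maps to the zero sequence exactly when each coset of x modulo I^n M is I^n M itself.
  The index 0 adds no condition, since I^0 M = M.\<close>

lemma kernel_to_completion:
  assumes "module R M" "ideal I R"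
  shows "a_kernel M (adic_completion R I M) (to_completion R I M) =
    (\<Inter>n. ideal_smult R (ideal_pow R I n) M)"
proof -
  interpret M: module R M by fact
  have sub: "submodule (ideal_smult R (ideal_pow R I n) M) R M" for n
    using ideal_ideal_pow[OF M.R.is_cring assms(2)]
    by (intro M.submodule_ideal_smult) (rule additive_subgroup.a_subset[OF ideal.axioms(1)])
  show ?thesis
    using M.submodule_carrier[OF sub] M.coset_eq_self_iff[OF sub]
    by (auto simp: a_kernel_def' to_completion_def adic_completion_def Let_def quot_map_def
        quot_module_def fun_eq_iff)
qed

theorem corollary8p23:
  fixes R :: "('a, 'r) ring_scheme"
    and E :: "('a, 'e, 'x) module_scheme"
    and I :: "'a set"
    and M :: "('a, 'm) module"
  assumes "complete_local_noetherian R"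
    and "injective_hull R (residue_field R) E"
    and "ideal I R"
    and "module R M"
    and "matlis_dualizable R E M"
  shows "smile_dual R E (local_cohomology0 R I) M =
           smile_dual R E (direct_limit_sel (\<lambda>n. trace_sel R (cyclic_module R (ideal_pow R I n)))) M
       \<and> smile_dual R E (direct_limit_sel (\<lambda>n. trace_sel R (cyclic_module R (ideal_pow R I n)))) M =
           inverse_limit_sel (\<lambda>n. smile_dual R E (trace_sel R (cyclic_module R (ideal_pow R I n)))) M
       \<and> inverse_limit_sel (\<lambda>n. smile_dual R E (trace_sel R (cyclic_module R (ideal_pow R I n)))) M =
           inverse_limit_sel (\<lambda>n. tom_sel R (cyclic_module R (ideal_pow R I n))) M
       \<and> inverse_limit_sel (\<lambda>n. tom_sel R (cyclic_module R (ideal_pow R I n))) M =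
           (\<Inter>n. ideal_smult R (ideal_pow R I n) M)
       \<and> (\<Inter>n. ideal_smult R (ideal_pow R I n) M) =
           a_kernel M (adic_completion R I M) (to_completion R I M)"
proof -
  interpret M: module R M by fact
  have E: "module R E" using assms(2) by (simp add: injective_hull_def injective_module_def)
  have R: "noetherian_ring R" "local_ring R"
    using assms(1) by (simp_all add: complete_local_noetherian_def)
  let ?J = "ideal_pow R I"
  let ?D = "dual R E M"
  let ?tr = "\<lambda>n. trace_sel R (cyclic_module R (?J n))"
  have D: "module R ?D" unfolding dual_def by (rule M.module_hom_module[OF E])
  have J: "ideal (?J n) R" for n by (rule ideal_ideal_pow[OF M.R.is_cring assms(3)])
  then have JR: "?J n \<subseteq> carrier R" for n
    by (rule additive_subgroup.a_subset[OF ideal.axioms(1)])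
  note tr = trace_cyclic_module[OF D J]
  \<comment> \<open>On the dual of M the trace of R/I^n is the annihilator of I^n, so both selectors
    are the union of these annihilators.\<close>
  have "local_cohomology0 R I ?D = direct_limit_sel ?tr ?D"
    by (simp add: local_cohomology0_def direct_limit_sel_def tr)
  then have 1: "smile_dual R E (local_cohomology0 R I) M = smile_dual R E (direct_limit_sel ?tr) M"
    by (rule smile_dual_cong)
  have 2: "smile_dual R E (direct_limit_sel ?tr) M = inverse_limit_sel (\<lambda>n. smile_dual R E (?tr n)) M"
  proof (rule smile_dual_direct_limit[OF assms(4) E])
    show "submodule (?tr n ?D) R ?D" for n unfolding tr by (rule submodule_annihilated[OF D JR])
    \<comment> \<open>Higher powers are smaller ideals, so their annihilators grow with the
      exponent.\<close>
    show "?tr m ?D \<subseteq> ?tr n ?D" if "m \<le> n" for m n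
      using ideal_pow_antimono[OF M.R.is_cring assms(3) that] unfolding tr by blast
  qed
  have 3: "smile_dual R E (?tr n) M = ideal_smult R (?J n) M" for n
    by (rule smile_dual_annihilated[OF R assms(2,4) J]) (rule tr)
  have 4: "tom_sel R (cyclic_module R (?J n)) M = ideal_smult R (?J n) M" for n
    by (rule tom_cyclic_module[OF R assms(2,4) J])
  \<comment> \<open>By \<open>3\<close> and \<open>4\<close> both inverse limits are, term by term,
    the intersection of the I^n M.\<close>
  show ?thesis
    using 1 2 kernel_to_completion[OF assms(4,3)] by (simp add: inverse_limit_sel_def 3 4)
qed

end
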